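(* Let $a:[0,1]\times[0,2\pi]\to\mathbb{C}$ be a function with Fourier series $a(x,t)=\sum_{k\in\mathbb{Z}}\hat a_k(x)e^{ikt}$ such that $x\mapsto a(x,t)$ is Riemann integrable on $[0,1]$ for every $t$, $t\mapsto a(x,t)$ belongs to $L^\infty([0,2\pi])$ for every $x$, and $\sum_{k\in\mathbb{Z}}\|\hat a_k\|_\infty<\infty$. Then the extended range $\mathcal{ER}(a)$ is a cluster of the eigenvalues of the KMS matrices $T_n(a)$; that is, for every open set $V\subset\mathbb{C}$ containing $\mathcal{ER}(a)$, $$\lim_{n\to\infty}\frac{\mathcal{N}(V,n)}{n+1}=1,$$ where $\mathcal{N}(V,n)$ is the number of eigenvalues of $T_n(a)$ (counted with algebraic multiplicity) that lie in $V$.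
   Context: For a function $a(x,t)$ on $[0,1]\times[0,2\pi]$ with Fourier series $a(x,t)=\sum_{k\in\mathbb{Z}}\hat a_k(x)e^{ikt}$, where $\hat a_k(x)=\frac1{2\pi}\int_0^{2\pi}a(x,t)e^{-ikt}\,dt$, the Kac-Murdock-Szegő (KMS) matrix with symbol $a$ is the $(n+1)\times(n+1)$ matrix $$T_n(a)=\left[\hat a_{j-i}\left(\frac{i+j}{2n+2}\right)\right]_{i,j=0}^n .$$ Here $\|\hat a_k\|_\infty=\sup_{x\in[0,1]}|\hat a_k(x)|$. When $\sum_k\|\hat a_k\|_\infty<\infty$ the Fourier series converges absolutely and uniformly, and $a$ is identified with its sum. The essential range of $a$ is $$\mathcal{R}(a)=\{z\in\mathbb{C}:\ \operatorname{meas}(a^{-1}(D_r(z)))>0\ \text{ for all } r>0\},$$ where $\operatorname{meas}$ is Lebesgue measure on $[0,1]\times[0,2\pi]$ and $D_r(z)$ is the open disk of radius $r$ centered at $z$. Since $\mathcal{R}(a)$ is compact, $\mathbb{C}\setminus\mathcal{R}(a)$ has exactly one unbounded connected component $U_0$. The extended range of $a$ is $\mathcal{ER}(a)=\mathbb{C}\setminus U_0$, i.e. the union of $\mathcal{R}(a)$ and all bounded components of its complement. *)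

theory Defs
  imports "HOL-Probability.Essential_Supremum" "Jordan_Normal_Form.Char_Poly"
begin

text \<open>
  Riemann's definition, by tagged divisions whose mesh tends to 0; Henstock--Kurzweil integrability,
  \<^const>\<open>integrable_on\<close>, and Lebesgue integrability are both weaker notions.
\<close>
definition riemann_integrable_on :: "(real \<Rightarrow> 'b::real_normed_vector) \<Rightarrow> real set \<Rightarrow> bool"
  (infixr "riemann'_integrable'_on" 46) where
  "f riemann_integrable_on S \<longleftrightarrow>
     (\<exists>I. \<forall>e>0. \<exists>d>0. \<forall>p. p tagged_division_of S \<and> (\<forall>(x, K)\<in>p. diameter K < d) \<longrightarrow>
        norm ((\<Sum>(x, K)\<in>p. measure lborel K *\<^sub>R f x) - I) < e)"

definition in_L_infinity :: "real set \<Rightarrow> (real \<Rightarrow> complex) \<Rightarrow> bool" where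
  "in_L_infinity S f \<longleftrightarrow>
     f \<in> borel_measurable (lebesgue_on S) \<and> esssup (lebesgue_on S) (\<lambda>t. ennreal (cmod (f t))) < \<infinity>"

definition fourier_coeff :: "(real \<Rightarrow> real \<Rightarrow> complex) \<Rightarrow> int \<Rightarrow> real \<Rightarrow> complex" where
  "fourier_coeff a k x =
     1 / (2 * pi) * (LINT t:{0..2*pi}|lebesgue. a x t * exp (- \<i> * of_int k * of_real t))"

text \<open>Valued in \<^typ>\<open>ennreal\<close>, so that an unbounded coefficient has norm \<open>\<infinity>\<close>.\<close>
definition fourier_coeff_sup_norm :: "(real \<Rightarrow> real \<Rightarrow> complex) \<Rightarrow> int \<Rightarrow> ennreal" where
  "fourier_coeff_sup_norm a k = (SUP x\<in>{0..1}. ennreal (cmod (fourier_coeff a k x)))"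

definition kms_matrix :: "(real \<Rightarrow> real \<Rightarrow> complex) \<Rightarrow> nat \<Rightarrow> complex Matrix.mat" where
  "kms_matrix a n = Matrix.mat (n + 1) (n + 1)
     (\<lambda>(i, j). fourier_coeff a (int j - int i) (real (i + j) / real (2 * n + 2)))"

text \<open>
  The measure is the completed one: under the hypotheses of interest \<open>a\<close> is Lebesgue but not
  necessarily Borel measurable on the rectangle.
\<close>
definition essential_range :: "(real \<Rightarrow> real \<Rightarrow> complex) \<Rightarrow> complex set" where
  "essential_range a =
     {z. \<forall>r>0. emeasure lebesgue ((\<lambda>(x, t). a x t) -` ball z r \<inter> {0..1} \<times> {0..2*pi}) > 0}"

definition extended_range :: "(real \<Rightarrow> real \<Rightarrow> complex) \<Rightarrow> complex set" where
  "extended_range a =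
     essential_range a \<union> \<Union> {U \<in> components (- essential_range a). bounded U}"

lemma extended_range_eq_complement:
  "extended_range a = - \<Union> {U \<in> components (- essential_range a). \<not> bounded U}"
proof -
  let ?R = "essential_range a"
  have U: "\<Union> (components (- ?R)) = - ?R"
    by (rule Union_components)
  have "U = W" if "U \<in> components (- ?R)" "W \<in> components (- ?R)" "z \<in> U" "z \<in> W" for U W z
    using components_nonoverlap[OF that(1,2)] that(3,4) by blast
  then have "z \<in> extended_range a \<longleftrightarrow>
      z \<in> - \<Union> {U \<in> components (- ?R). \<not> bounded U}" for z
    using U unfolding extended_range_def by (cases "z \<in> ?R") blast+
  then show ?thesis
    by blast
qed

definition eigenvalue_count :: "complex Matrix.mat \<Rightarrow> complex set \<Rightarrow> nat" where
  "eigenvalue_count A V = (\<Sum>z\<in>{z \<in> V. eigenvalue A z}. Polynomial.order z (char_poly A))"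

end

theory Submission
  imports Defs "Jordan_Normal_Form.Schur_Decomposition" "HOL-Library.Real_Mod"
begin

text \<open>
  Let \<open>A\<^sub>n\<close> be the matrix of order \<open>n\<close> and \<open>R\<close> the essential range of \<open>a\<close>. Schur's inequality bounds the sum
  of \<open>|p(\<lambda>)|\<^sup>2\<close> over the eigenvalues by \<open>\<parallel>p(A\<^sub>n)\<parallel>\<^sub>F\<^sup>2\<close>. In the mean over \<open>i < n\<close>, a truncation of \<open>A\<^sub>n\<close> acts
  on the wave \<open>e\<^sub>t(j) = e^(i j t)\<close> as multiplication by \<open>a(i/n, t)\<close>, because its diagonals are slowly varying
  (the coefficients are Riemann integrable). Hence so does \<open>p(A\<^sub>n)\<close>, with multiplier \<open>p(a(i/n, t))\<close>, and
  Parseval over finitely many \<open>t\<close> gives \<open>\<parallel>p(A\<^sub>n)\<parallel>\<^sub>F\<^sup>2 = O(d\<^sup>2 n)\<close> whenever \<open>|p| \<le> d\<close> on \<open>R\<close>. A point outside the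
  extended range lies in the unbounded component of the complement of \<open>R\<close>, so some polynomial has modulus
  greater than 1 there and at most 1/2 on \<open>R\<close>. Finitely many such polynomials suffice off \<open>V\<close>, and their high
  powers make the proportion of eigenvalues off \<open>V\<close> arbitrarily small.
\<close>

section \<open>Schur's inequality for polynomials in a matrix\<close>

text \<open>The matrices need not be normal, so their moments do not control where the eigenvalues
  lie; Schur's inequality holds without normality, and high powers of a polynomial turn its
  mean-square bound into a count. Two obstacles shape the rest. First, Riemann integrability gives
  limits for one frequency t at a time, without uniformity in t. A truncation is banded with a width
  independent of the order, hence so is a polynomial in it, and the number of frequencies in
  Parseval's identity stays fixed as the order grows. Second, the essential range ignores null sets,
  while the entries are sampled at grid points, which form a null set, so \<open>a(i/n, t)\<close>
  may well lie outside R. Since the mean oscillation over the cells vanishes, a grid point may be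
  replaced by any point of its cell, and every cell contains points x with \<open>a(x, t)\<close> in
  R. This has to hold for every t, not for almost every t; it does because summable coefficients
  make \<open>a\<close> equicontinuous in t.\<close>

definition mat_poly :: "'a::comm_ring_1 mat \<Rightarrow> 'a poly \<Rightarrow> 'a mat" where
  "mat_poly A p = fold_coeffs (\<lambda>a M. a \<cdot>\<^sub>m 1\<^sub>m (dim_row A) + A * M) p (0\<^sub>m (dim_row A) (dim_row A))"

lemma mat_poly_0 [simp]: "A \<in> carrier_mat n n \<Longrightarrow> mat_poly A 0 = 0\<^sub>m n n"
  by (simp add: mat_poly_def)

lemma mat_poly_pCons:
  assumes "A \<in> carrier_mat n n"
  shows "mat_poly A (pCons a p) = a \<cdot>\<^sub>m 1\<^sub>m n + A * mat_poly A p"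
proof -
  \<comment> \<open>For \<open>pCons 0 0 = 0\<close> the fold performs no step, so Horner's step has
    to fix the zero matrix.\<close>
  have z: "0 \<cdot>\<^sub>m 1\<^sub>m n + A * 0\<^sub>m n n = 0\<^sub>m n n"
    using assms by (intro eq_matI) auto
  show ?thesis
    using assms z by (cases "p = 0 \<and> a = 0") (auto simp: mat_poly_def)
qed

lemma mat_poly_carrier [simp]: "A \<in> carrier_mat n n \<Longrightarrow> mat_poly A p \<in> carrier_mat n n"
  by (induction p) (auto simp: mat_poly_pCons)

lemma mat_poly_pCons_index:
  assumes "A \<in> carrier_mat n n" "i < n" "j < n"
  shows "mat_poly A (pCons a p) $$ (i, j) =
    (if i = j then a else 0) + (\<Sum>k<n. A $$ (i, k) * mat_poly A p $$ (k, j))"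
  using assms carrier_matD[OF mat_poly_carrier[OF assms(1), of p]]
  by (simp add: mat_poly_pCons scalar_prod_def atLeast0LessThan)

lemma mat_poly_similar:
  assumes A: "A \<in> carrier_mat n n" and U: "U \<in> carrier_mat n n" and V: "V \<in> carrier_mat n n"
    and VU: "V * U = 1\<^sub>m n" and UV: "U * V = 1\<^sub>m n"
  shows "mat_poly (V * A * U) p = V * mat_poly A p * U"
proof (induction p)
  case 0
  then show ?case using A U V by simp
next
  case (pCons a p)
  let ?M = "mat_poly A p"
  have M: "?M \<in> carrier_mat n n" using A by simp
  have VAU: "V * A * U \<in> carrier_mat n n" using A U V by simp
  have as: "X * Y * Z = X * (Y * Z)" "X * Y \<in> carrier_mat n n"
    if "X \<in> carrier_mat n n" "Y \<in> carrier_mat n n" "Z \<in> carrier_mat n n" for X Y Z :: "'a mat"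
    using that by auto
  have UVZ: "U * (V * Z) = Z" if "Z \<in> carrier_mat n n" for Z
    using as(1)[OF U V that] UV that by simp
  have 1: "V * A * U * (V * ?M * U) = V * (A * ?M) * U"
    using A U V M by (simp add: as UVZ)
  have 2: "V * (a \<cdot>\<^sub>m 1\<^sub>m n + A * ?M) * U = a \<cdot>\<^sub>m 1\<^sub>m n + V * (A * ?M) * U"
  proof -
    have "V * (a \<cdot>\<^sub>m 1\<^sub>m n + A * ?M) * U = V * (a \<cdot>\<^sub>m 1\<^sub>m n) * U + V * (A * ?M) * U"
      using A U V M by (simp add: mult_add_distrib_mat[of _ n n _ n] add_mult_distrib_mat[of _ n n _ _ n])
    also have "V * (a \<cdot>\<^sub>m 1\<^sub>m n) * U = a \<cdot>\<^sub>m 1\<^sub>m n"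
      using U V by (simp add: mult_smult_distrib[of _ n n _ n] mult_smult_assoc_mat[of _ n n _ n] VU)
    finally show ?thesis .
  qed
  show ?case
    unfolding mat_poly_pCons[OF VAU] mat_poly_pCons[OF A] pCons.IH 1 2 ..
qed

section \<open>Frobenius norm, unitary invariance and deflation of one eigenvalue\<close>

definition frob :: "complex mat \<Rightarrow> real" where
  "frob M = (\<Sum>i<dim_row M. \<Sum>j<dim_col M. (cmod (M $$ (i, j)))\<^sup>2)"

definition adj :: "complex mat \<Rightarrow> complex mat" where
  "adj M = Matrix.mat (dim_col M) (dim_row M) (\<lambda>(i, j). cnj (M $$ (j, i)))"

lemma adj_carrier [simp]: "M \<in> carrier_mat n m \<Longrightarrow> adj M \<in> carrier_mat m n"
  by (auto simp: adj_def)

lemma adj_adj [simp]: "adj (adj M) = M"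
  by (intro eq_matI) (auto simp: adj_def)

lemma adj_mult:
  assumes "A \<in> carrier_mat n m" "B \<in> carrier_mat m k"
  shows "adj (A * B) = adj B * adj A"
  using assms by (intro eq_matI) (auto simp: adj_def scalar_prod_def mult.commute)

lemma frob_adj: "frob (adj M) = frob M"
  unfolding frob_def adj_def by (subst sum.swap) (auto intro!: sum.cong)

lemma frob_eq_trace:
  assumes "M \<in> carrier_mat n m"
  shows "complex_of_real (frob M) = (\<Sum>j<m. (adj M * M) $$ (j, j))"
  using assms unfolding frob_def
  by (subst sum.swap)
     (auto simp: adj_def scalar_prod_def complex_norm_square mult.commute atLeast0LessThan
       simp flip: of_real_power intro!: sum.cong)

lemma frob_unitary_left:
  assumes U: "U \<in> carrier_mat n n" and UU: "adj U * U = 1\<^sub>m n" and M: "M \<in> carrier_mat n m"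
  shows "frob (U * M) = frob M"
proof -
  note aU = adj_carrier[OF U] and aM = adj_carrier[OF M]
  have "adj (U * M) * (U * M) = adj M * adj U * (U * M)"
    by (simp add: adj_mult[OF U M])
  also have "\<dots> = adj M * (adj U * (U * M))"
    by (rule assoc_mult_mat[OF aM aU mult_carrier_mat[OF U M]])
  also have "adj U * (U * M) = M"
    using assoc_mult_mat[OF aU U M] UU M by simp
  finally have "adj (U * M) * (U * M) = adj M * M" .
  then have "complex_of_real (frob (U * M)) = complex_of_real (frob M)"
    using U M frob_eq_trace[of "U * M" n m] frob_eq_trace[OF M] by simp
  then show ?thesis by simp
qed

lemma frob_unitary_right:
  assumes U: "U \<in> carrier_mat n n" and UU: "U * adj U = 1\<^sub>m n" and M: "M \<in> carrier_mat m n"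
  shows "frob (M * U) = frob M"
  using frob_unitary_left[of "adj U" n "adj M" m] U M UU
  by (metis adj_adj adj_carrier adj_mult frob_adj)

text \<open>One step of Schur's triangularisation: an eigenvector is completed to a basis, which is
  then orthogonalised and becomes the columns of \<open>U\<close>. The change of basis is unitary so
  that \<open>frob\<close> is preserved.\<close>

lemma unitary_deflation:
  fixes A :: "complex mat"
  assumes A: "A \<in> carrier_mat n n" and e: "eigenvalue A e"
  obtains U where "U \<in> carrier_mat n n" "adj U * U = 1\<^sub>m n" "U * adj U = 1\<^sub>m n"
    "\<And>i. i < n \<Longrightarrow> (adj U * A * U) $$ (i, 0) = (if i = 0 then e else 0)"
proof -
  obtain v0 where "eigenvector A v0 e"
    using e unfolding eigenvalue_def by blast
  then have v0: "v0 \<in> carrier_vec n" "v0 \<noteq> 0\<^sub>v n" "A *\<^sub>v v0 = e \<cdot>\<^sub>v v0"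
    using A by (auto simp: eigenvector_def)
  then have n: "n \<noteq> 0"
    by (auto simp: vec_eq_iff)
  interpret cof_vec_space n "TYPE(complex)" .
  note bc = basis_completion[OF v0(1,2)]
  define b where "b = basis_completion v0"
  have b: "distinct b" "\<not> lin_dep (set b)" "set b \<subseteq> carrier_vec n" "hd b = v0" "length b = n"
    using bc unfolding b_def by auto
  obtain vs where bv: "b = v0 # vs"
    using b(4,5) n by (cases b) auto
  define ws where "ws = gram_schmidt n b"
  from gram_schmidt_result[OF b(3,1,2) refl, folded ws_def]
  have ws: "set ws \<subseteq> carrier_vec n" "corthogonal ws" "length ws = n"
    by (auto simp: b(5))
  \<comment> \<open>Gram-Schmidt leaves the first vector alone, so an eigenvector still heads the
    list.\<close>
  have hdws: "ws ! 0 = v0"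
    using gram_schmidt_hd[OF v0(1), of vs, folded bv ws_def] ws(3) n
    by (cases ws) auto
  \<comment> \<open>\<open>gram_schmidt\<close> does not normalise; the vectors are divided by their
    lengths \<open>r i\<close>.\<close>
  define r where "r i = sqrt (\<Sum>k<n. (cmod (ws ! i $ k))\<^sup>2)" for i
  have wsc: "ws ! i \<in> carrier_vec n" if "i < n" for i
    using ws that by auto
  have sp: "ws ! i \<bullet>c ws ! j = (\<Sum>k<n. ws ! i $ k * cnj (ws ! j $ k))" if "i < n" "j < n" for i j
    using wsc[OF that(1)] wsc[OF that(2)] by (simp add: scalar_prod_def atLeast0LessThan)
  have sq: "ws ! i \<bullet>c ws ! i = complex_of_real ((r i)\<^sup>2)" if "i < n" for i
    unfolding sp[OF that that] r_def
    by (simp add: sum_nonneg complex_norm_square del: of_real_power flip: of_real_power)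
  have r0: "r i \<noteq> 0" if "i < n" for i
    using sq[OF that] corthogonalD[OF ws(2), of i i] ws(3) that by auto
  define U where "U = Matrix.mat n n (\<lambda>(k, i). ws ! i $ k / complex_of_real (r i))"
  have U: "U \<in> carrier_mat n n"
    by (simp add: U_def)
  have UU: "adj U * U = 1\<^sub>m n"
  proof (rule eq_matI)
    fix i j assume "i < dim_row (1\<^sub>m n :: complex mat)" "j < dim_col (1\<^sub>m n :: complex mat)"
    then have ij: "i < n" "j < n" by auto
    have "(adj U * U) $$ (i, j) = (\<Sum>k<n. ws ! j $ k * cnj (ws ! i $ k)) / (r i * r j)"
      using ij unfolding sum_divide_distrib
      by (simp add: U_def adj_def scalar_prod_def atLeast0LessThan mult.commute)
    also have "\<dots> = (if i = j then 1 else 0)"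
      using corthogonalD[OF ws(2), of j i] ws(3) ij sq[of i] r0[of i]
      by (auto simp flip: sp simp: power2_eq_square)
    finally show "(adj U * U) $$ (i, j) = 1\<^sub>m n $$ (i, j)"
      using ij by simp
  qed (use U in \<open>auto simp: adj_def\<close>)
  have UU': "U * adj U = 1\<^sub>m n"
    by (rule mat_mult_left_right_inverse[OF adj_carrier[OF U] U UU])
  have colU: "col U 0 = (1 / complex_of_real (r 0)) \<cdot>\<^sub>v v0"
    using n v0(1) hdws by (intro eq_vecI) (auto simp: U_def)
  have AU: "A *\<^sub>v col U 0 = e \<cdot>\<^sub>v col U 0"
    unfolding colU using A v0 by (simp add: mult_mat_vec smult_smult_assoc mult.commute)
  have "(adj U * A * U) $$ (i, 0) = (if i = 0 then e else 0)" if i: "i < n" for i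
  proof -
    have "(adj U * A * U) $$ (i, 0) = (adj U * (A * U)) $$ (i, 0)"
      by (simp add: assoc_mult_mat[OF adj_carrier[OF U] A U])
    also have "\<dots> = row (adj U) i \<bullet> (A *\<^sub>v col U 0)"
      using i n A U carrier_matD[OF adj_carrier[OF U]] col_mult2[OF A U, of 0]
      by (subst index_mult_mat(1)) (auto simp del: col_mult2)
    also have "\<dots> = e * (row (adj U) i \<bullet> col U 0)"
      unfolding AU using U adj_carrier[OF U] i by (intro scalar_prod_smult_distrib[of _ n]) auto
    also have "row (adj U) i \<bullet> col U 0 = (adj U * U) $$ (i, 0)"
      using i n U carrier_matD[OF adj_carrier[OF U]] by (subst index_mult_mat(1)) auto
    finally show ?thesis
      using i n by (simp add: UU)
  qed
  then show thesis
    using that U UU UU' by blast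
qed

text \<open>Induction over the eigenvalues by deflation: \<open>B\<close> is block upper triangular
  with diagonal blocks \<open>e\<close> and \<open>C\<close>, so \<open>p(B)\<close> has the
  diagonal blocks \<open>p(e)\<close> and \<open>p(C)\<close>, and its other entries can only
  enlarge the Frobenius sum.\<close>

lemma schur_inequality:
  fixes A :: "complex mat"
  assumes "A \<in> carrier_mat n n" and "char_poly A = (\<Prod>e\<leftarrow>es. [:- e, 1:])"
  shows "(\<Sum>e\<leftarrow>es. (cmod (poly p e))\<^sup>2) \<le> frob (mat_poly A p)"
  using assms
proof (induction es arbitrary: A n)
  case Nil
  then show ?case
    by (simp add: frob_def sum_nonneg)
next
  case (Cons e es)
  note A = Cons.prems(1)
  have "eigenvalue A e"
    unfolding eigenvalue_root_char_poly[OF A] Cons.prems(2) by simp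
  then obtain U where U: "U \<in> carrier_mat n n" and UU: "adj U * U = 1\<^sub>m n" "U * adj U = 1\<^sub>m n"
    and col0: "\<And>i. i < n \<Longrightarrow> (adj U * A * U) $$ (i, 0) = (if i = 0 then e else 0)"
    using unitary_deflation[OF A] by metis
  note aU = adj_carrier[OF U]
  define B where "B = adj U * A * U"
  have B: "B \<in> carrier_mat n n"
    unfolding B_def by (intro mult_carrier_mat[of _ _ n] aU A U)
  \<comment> \<open>A matrix with an eigenvalue has positive order, so a first row and column can be
    split off.\<close>
  have "degree (char_poly A) \<noteq> 0"
    using \<open>eigenvalue A e\<close> degree_monic_char_poly[OF A] unfolding eigenvalue_root_char_poly[OF A]
    by (metis coeff_pCons_0 degree_eq_zeroE degree_pCons_0 poly_const_conv zero_neq_one)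
  then obtain m where n: "n = Suc m"
    using degree_monic_char_poly[OF A] by (cases n) auto
  define C where "C = Matrix.mat m m (\<lambda>(i, j). B $$ (Suc i, Suc j))"
  have C: "C \<in> carrier_mat m m" by (simp add: C_def)
  have Bblock: "B = four_block_mat (Matrix.mat 1 1 (\<lambda>_. e)) (Matrix.mat 1 m (\<lambda>(i, j). B $$ (0, Suc j))) (0\<^sub>m m 1) C"
    using B n col0[folded B_def] by (intro eq_matI) (auto simp: C_def)
  have sim: "similar_mat B A"
    unfolding similar_mat_def using similar_mat_witI[OF UU B_def B A aU U] by blast
  have "char_poly B = char_poly (Matrix.mat 1 1 (\<lambda>_. e)) * char_poly C"
    unfolding arg_cong[OF Bblock, of char_poly] by (rule char_poly_four_block_zeros_col[OF _ _ C]) auto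
  then have "[:- e, 1:] * char_poly C = char_poly B"
    by (simp add: char_poly_defs det_def sign_def)
  also have "\<dots> = [:- e, 1:] * (\<Prod>e\<leftarrow>es. [:- e, 1:])"
    using char_poly_similar[OF sim] Cons.prems(2) by simp
  finally have "char_poly C = (\<Prod>e\<leftarrow>es. [:- e, 1:])"
    by (metis mult_cancel_left pCons_eq_0_iff zero_neq_one)
  then have IH: "(\<Sum>e\<leftarrow>es. (cmod (poly p e))\<^sup>2) \<le> frob (mat_poly C p)"
    by (rule Cons.IH[OF C])
  \<comment> \<open>Block triangularity survives Horner's scheme, which is why the three claims are
    proved together; the first row to the right of the diagonal stays arbitrary.\<close>
  have ent: "mat_poly B q $$ (0, 0) = poly q e \<and> (\<forall>i<m. mat_poly B q $$ (Suc i, 0) = 0) \<and>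
     (\<forall>i<m. \<forall>j<m. mat_poly B q $$ (Suc i, Suc j) = mat_poly C q $$ (i, j))" for q
  proof (induction q)
    case 0
    show ?case using B C n by simp
  next
    case (pCons a q)
    have CB: "C $$ (i, k) = B $$ (Suc i, Suc k)" if "i < m" "k < m" for i k
      using that by (simp add: C_def)
    show ?case
      using pCons.IH col0[folded B_def] n
      by (auto simp: mat_poly_pCons_index[OF B] mat_poly_pCons_index[OF C] CB
        lessThan_Suc_eq_insert_0 sum.reindex)
  qed
  have "(\<Sum>e\<leftarrow>e # es. (cmod (poly p e))\<^sup>2) \<le> (cmod (poly p e))\<^sup>2 + frob (mat_poly C p)"
    using IH by simp
  also have "\<dots> = (cmod (mat_poly B p $$ (0, 0)))\<^sup>2 +
      (\<Sum>i<m. \<Sum>j<m. (cmod (mat_poly B p $$ (Suc i, Suc j)))\<^sup>2)"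
    using ent[of p] mat_poly_carrier[OF C, of p] by (auto simp: frob_def)
  \<comment> \<open>Here the part of the first row above the diagonal blocks is thrown in, the only
    loss of this step.\<close>
  also have "\<dots> \<le> (cmod (mat_poly B p $$ (0, 0)))\<^sup>2 + (\<Sum>j<m. (cmod (mat_poly B p $$ (0, Suc j)))\<^sup>2)
      + (\<Sum>i<m. (cmod (mat_poly B p $$ (Suc i, 0)))\<^sup>2 + (\<Sum>j<m. (cmod (mat_poly B p $$ (Suc i, Suc j)))\<^sup>2))"
    by (simp add: sum.distrib sum_nonneg add_nonneg_nonneg)
  also have "\<dots> = frob (mat_poly B p)"
    using mat_poly_carrier[OF B, of p] n
    by (simp add: frob_def lessThan_Suc_eq_insert_0 sum.reindex)
  also have "mat_poly B p = adj U * (mat_poly A p * U)"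
    unfolding B_def mat_poly_similar[OF A U aU UU]
    by (rule assoc_mult_mat[OF aU _ U]) (use A in simp)
  also have "frob \<dots> = frob (mat_poly A p)"
    using A U UU aU
    by (metis adj_adj frob_unitary_left frob_unitary_right mat_poly_carrier mult_carrier_mat)
  finally show ?case .
qed

section \<open>Polynomials separating a compact set from the unbounded component of its complement\<close>

text \<open>For compact \<open>K\<close> this is the complement of the polynomially convex
  hull.\<close>

definition poly_separated :: "complex set \<Rightarrow> complex set" where
  "poly_separated K = {w. \<forall>d>0. \<exists>p. poly p w = 1 \<and> (\<forall>z\<in>K. cmod (poly p z) \<le> d)}"

text \<open>Powers of a single polynomial reach every tolerance.\<close>

lemma poly_separatedI:
  assumes "0 \<le> r" "r < 1" "poly p w = 1" "\<And>z. z \<in> K \<Longrightarrow> cmod (poly p z) \<le> r"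
  shows "w \<in> poly_separated K"
  unfolding poly_separated_def
proof safe
  fix d :: real assume "d > 0"
  obtain m where m: "r ^ m < d"
    using real_arch_pow_inv[OF \<open>d > 0\<close> assms(2)] by blast
  have "cmod (poly (p ^ m) z) \<le> d" if "z \<in> K" for z
    using power_mono[OF assms(4)[OF that], of m] m by (simp add: norm_power)
  then show "\<exists>p. poly p w = 1 \<and> (\<forall>z\<in>K. cmod (poly p z) \<le> d)"
    using assms(3) by (intro exI[of _ "p ^ m"]) simp
qed

lemma poly_separated_outside:
  assumes "\<And>z. z \<in> K \<Longrightarrow> cmod z \<le> C" "C < cmod w"  "0 \<le> C"
  shows "w \<in> poly_separated K"
proof (rule poly_separatedI)
  show "poly [:0, 1 / w:] w = 1"
    using assms by auto
  show "cmod (poly [:0, 1 / w:] z) \<le> C / cmod w" if "z \<in> K" for z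
    using assms(1)[OF that] by (simp add: norm_divide divide_right_mono)
qed (use assms in \<open>auto simp: divide_simps\<close>)

text \<open>
  If \<open>1 - (z - w') Q(z)\<close> is small on \<open>K\<close> then \<open>Q(z)\<close> approximates \<open>1 / (z - w')\<close> there, and with
  \<open>c = w - w'\<close> the geometric sum \<open>\<Sum>j<m. Q (c Q)^j\<close> approximates \<open>1 / (z - w)\<close>.
\<close>
lemma poly_separated_step:
  assumes w': "w' \<in> poly_separated K" and d: "0 < d" "\<And>z. z \<in> K \<Longrightarrow> d \<le> cmod (z - w')"
    and c: "cmod (w - w') \<le> d / 2"
  shows "w \<in> poly_separated K"
proof -
  \<comment> \<open>With tolerance 1/16, \<open>d * |Q|\<close> is at most 17/16, so
    \<open>|u|\<close> is at most 17/32 < 3/5, and three terms of the geometric series leave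
    \<open>(3/5)^3 + (1 + 3/5 + 9/25) / 16\<close>, which is below 1/2.\<close>
  obtain p where p: "poly p w' = 1" "\<And>z. z \<in> K \<Longrightarrow> cmod (poly p z) \<le> 1 / 16"
    using w' unfolding poly_separated_def by (auto dest!: spec[of _ "1/16"])
  have "poly (1 - p) w' = 0" using p by simp
  then obtain Q where Q: "1 - p = [:- w', 1:] * Q"
    unfolding poly_eq_0_iff_dvd dvd_def by blast
  have pz: "poly p z = 1 - (z - w') * poly Q z" for z
    using arg_cong[OF Q, of "\<lambda>q. poly q z"] by (simp add: algebra_simps)
  define u where "u z = (w - w') * poly Q z" for z
  \<comment> \<open>The factor \<open>z - w\<close> forces the value 1 at \<open>w\<close>; on
    \<open>K\<close>, \<open>(z - w) Q = 1 - p - u\<close> and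
    \<open>(1 - u) (1 + u + u^2) = 1 - u^3\<close> make \<open>P\<close> small.\<close>
  define P where "P = 1 - [:- w, 1:] * Q * (\<Sum>j<3. Polynomial.smult ((w - w') ^ j) (Q ^ j))"
  have P: "poly P z = u z ^ 3 + poly p z * (\<Sum>j<3. u z ^ j)" for z
  proof -
    have "(\<Sum>j<3. u z ^ j) = (\<Sum>j<3. (w - w') ^ j * poly Q z ^ j)"
      by (simp only: u_def power_mult_distrib)
    then have "poly P z = 1 - (z - w) * poly Q z * (\<Sum>j<3. u z ^ j)"
      by (simp add: P_def poly_sum left_diff_distrib)
    also have "(z - w) * poly Q z = 1 - poly p z - u z"
      by (simp add: pz u_def algebra_simps)
    also have "1 - (1 - poly p z - u z) * (\<Sum>j<3. u z ^ j) = u z ^ 3 + poly p z * (\<Sum>j<3. u z ^ j)"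
      by (simp add: eval_nat_numeral algebra_simps)
    finally show ?thesis .
  qed
  have u: "cmod (u z) \<le> 3 / 5" if z: "z \<in> K" for z
  proof -
    have "cmod (z - w') * cmod (poly Q z) = cmod (1 - poly p z)"
      by (simp add: pz norm_mult)
    also have "\<dots> \<le> 17 / 16"
      using norm_triangle_ineq4[of 1 "poly p z"] p(2)[OF z] by simp
    finally have "d * cmod (poly Q z) \<le> 17 / 16"
      using mult_right_mono[OF d(2)[OF z], of "cmod (poly Q z)"] by simp
    then have "d / 2 * cmod (poly Q z) \<le> 3 / 5" by simp
    then show ?thesis
      using mult_right_mono[OF c, of "cmod (poly Q z)"] by (simp add: u_def norm_mult)
  qed
  show ?thesis
  proof (rule poly_separatedI)
    show "poly P w = 1" by (simp add: P_def)
    show "cmod (poly P z) \<le> 1 / 2" if z: "z \<in> K" for z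
    proof -
      have "cmod (poly P z) \<le> cmod (u z) ^ 3 + cmod (poly p z) * (\<Sum>j<3. cmod (u z) ^ j)"
        unfolding P
        by (intro order_trans[OF norm_triangle_ineq] add_mono)
           (auto simp: norm_power norm_mult intro!: mult_left_mono sum_norm_le)
      also have "\<dots> \<le> (3 / 5) ^ 3 + 1 / 16 * (\<Sum>j<3. (3 / 5) ^ j)"
        using u[OF z] p(2)[OF z]
        by (intro add_mono mult_mono sum_mono power_mono sum_nonneg) auto
      also have "\<dots> \<le> 1 / 2" by (simp add: eval_nat_numeral)
      finally show ?thesis .
    qed
  qed auto
qed

text \<open>By connectedness of \<open>U\<close>: the separated points form a subset that is open
  and closed in \<open>U\<close> and, as \<open>U\<close> is unbounded, nonempty. Both topological
  claims rest on the reach of the step lemma, half the distance to \<open>K\<close>, which does not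
  depend on the separating polynomial.\<close>

lemma unbounded_component_poly_separated:
  assumes K: "compact K" and U: "U \<in> components (- K)" "\<not> bounded U"
  shows "U \<subseteq> poly_separated K"
proof -
  have oU: "open U"
    using U(1) K by (meson compact_imp_closed open_Compl open_components)
  have UK: "U \<subseteq> - K" by (rule in_components_subset[OF U(1)])
  have step: "ball w' (r / 2) \<subseteq> poly_separated K" if "w' \<in> poly_separated K" "ball w' r \<subseteq> U" "r > 0" for w' r
  proof
    fix w assume "w \<in> ball w' (r / 2)"
    moreover have "r \<le> cmod (z - w')" if "z \<in> K" for z
      using that UK \<open>ball w' r \<subseteq> U\<close> by (force simp: dist_norm norm_minus_commute)
    ultimately show "w \<in> poly_separated K"
      using that by (intro poly_separated_step[of w' K r w]) (auto simp: dist_norm norm_minus_commute)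
  qed
  have o1: "open (U \<inter> poly_separated K)"
    unfolding open_contains_ball
  proof safe
    fix w assume w: "w \<in> U" "w \<in> poly_separated K"
    obtain r where "r > 0" "ball w r \<subseteq> U" using oU w(1) open_contains_ball by blast
    with step[OF w(2), of r] show "\<exists>e>0. ball w e \<subseteq> U \<inter> poly_separated K"
      by (intro exI[of _ "r / 2"]) auto
  qed
  have o2: "open (U - poly_separated K)"
    unfolding open_contains_ball
  proof safe
    fix w assume w: "w \<in> U" "w \<notin> poly_separated K"
    obtain r where r: "r > 0" "ball w r \<subseteq> U" using oU w(1) open_contains_ball by blast
    \<comment> \<open>A separated point within r/4 of \<open>w\<close> has a ball of radius 3r/4
      inside \<open>U\<close>, hence reach 3r/8 > r/4, and would make \<open>w\<close>
      separated.\<close>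
    have "w' \<notin> poly_separated K" if "w' \<in> ball w (r / 4)" for w'
    proof
      assume "w' \<in> poly_separated K"
      moreover have "ball w' (3 * r / 4) \<subseteq> ball w r"
        using that by (intro ball_subset_ball_iff[THEN iffD2]) (auto simp: dist_commute)
      ultimately have "ball w' (3 * r / 4 / 2) \<subseteq> poly_separated K"
        using r by (intro step) auto
      moreover have "w \<in> ball w' (3 * r / 4 / 2)" using that r by (auto simp: dist_commute)
      ultimately show False using w by blast
    qed
    then show "\<exists>e>0. ball w e \<subseteq> U - poly_separated K"
      using r by (intro exI[of _ "r / 4"]) force
  qed
  obtain C where C: "C \<ge> 0" "\<And>z. z \<in> K \<Longrightarrow> cmod z \<le> C"
    using compact_imp_bounded[OF K] by (metis bounded_pos less_imp_le)
  obtain w where "w \<in> U" "C < cmod w"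
    using U(2) by (auto simp: bounded_iff not_le)
  then have "U \<inter> poly_separated K \<noteq> {}"
    using poly_separated_outside[of K C w] C by auto
  moreover have "connected U" by (rule in_components_connected[OF U(1)])
  ultimately have "U \<inter> (U - poly_separated K) = {}"
    using connectedD[OF _ o1 o2] by auto
  then show ?thesis by auto
qed

text \<open>Only finitely many polynomials are needed, since the identity takes care of a neighbourhood of infinity.\<close>
lemma finite_poly_separating_family:
  assumes K: "compact K" and V: "open V" "K \<union> \<Union> {U \<in> components (- K). bounded U} \<subseteq> V"
  obtains F where "finite F" "\<And>p z. p \<in> F \<Longrightarrow> z \<in> K \<Longrightarrow> cmod (poly p z) \<le> 1 / 2"
    "\<And>w. w \<notin> V \<Longrightarrow> \<exists>p\<in>F. 1 \<le> cmod (poly p w)"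
proof -
  obtain C where C: "C > 0" "\<And>z. z \<in> K \<Longrightarrow> cmod z \<le> C"
    using compact_imp_bounded[OF K] bounded_pos by metis
  define Q where "Q = {p. \<forall>z\<in>K. cmod (poly p z) \<le> 1 / 2}"
  have "\<exists>p\<in>Q. 1 < cmod (poly p w)" if "w \<notin> V" for w
  proof -
    have "w \<in> - K" "w \<notin> \<Union> {U \<in> components (- K). bounded U}"
      using V(2) that by blast+
    then obtain U where "U \<in> components (- K)" "\<not> bounded U" "w \<in> U"
      using Union_components[of "- K"] by blast
    then have "w \<in> poly_separated K"
      using unbounded_component_poly_separated[OF K] by blast
    \<comment> \<open>After doubling, the bound 1/4 on \<open>K\<close> becomes 1/2 and the value at
      \<open>w\<close> becomes 2; being strictly above 1 is an open condition, as the covering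
      argument requires.\<close>
    then obtain p where p: "poly p w = 1" "\<forall>z\<in>K. cmod (poly p z) \<le> 1 / 4"
      unfolding poly_separated_def by (auto dest!: spec[of _ "1/4"])
    then show ?thesis
      by (intro bexI[of _ "Polynomial.smult 2 p"]) (auto simp: Q_def norm_mult)
  qed
  then have cov: "cball 0 (2 * C) - V \<subseteq> (\<Union>p\<in>Q. {w. 1 < cmod (poly p w)})"
    by blast
  have "compact (cball 0 (2 * C) - V)"
    by (intro compact_diff V(1)) auto
  moreover have "open {w. 1 < cmod (poly p w)}" for p :: "complex poly"
    by (intro open_Collect_less continuous_intros)
  ultimately obtain F where F: "F \<subseteq> Q" "finite F" "cball 0 (2 * C) - V \<subseteq> (\<Union>p\<in>F. {w. 1 < cmod (poly p w)})"
    using compactE_image[OF _ _ cov] by metis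
  \<comment> \<open>At most 1/2 on \<open>K\<close> and above 1 in modulus outside the disc of
    radius \<open>2 * C\<close>.\<close>
  define q where "q = [:0, 1 / complex_of_real (2 * C):]"
  show thesis
  proof (rule that[of "insert q F"])
    show "cmod (poly p z) \<le> 1 / 2" if "p \<in> insert q F" "z \<in> K" for p z
      using that F(1) C(1) C(2)[of z] by (auto simp: Q_def q_def norm_divide divide_simps)
    show "\<exists>p\<in>insert q F. 1 \<le> cmod (poly p w)" if "w \<notin> V" for w
    proof (cases "cmod w \<le> 2 * C")
      case True
      then have "w \<in> (\<Union>p\<in>F. {w. 1 < cmod (poly p w)})" using F(3) that by auto
      then show ?thesis by force
    next
      case False
      then show ?thesis using C(1) by (auto simp: q_def norm_divide)
    qed
  qed (use F in auto)
qed

section \<open>Riemann integrability and mean oscillation\<close>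

lemma tendsto_zero_sandwich:
  fixes f g :: "nat \<Rightarrow> real"
  assumes "g \<longlonglongrightarrow> 0" "\<And>n. 0 \<le> f n" "\<And>n. f n \<le> g n"
  shows "f \<longlonglongrightarrow> 0"
  by (rule tendsto_sandwich[OF _ _ tendsto_const assms(1)]) (simp_all add: assms)

lemma mean_nonneg: "(\<And>i. i \<in> A \<Longrightarrow> 0 \<le> f i) \<Longrightarrow> 0 \<le> (\<Sum>i\<in>A. f i) / real N"
  by (simp add: sum_nonneg)

text \<open>The freedom of choice is used twice: to exchange tags between two families, and to move
  tags to points with values in the essential range.\<close>

definition cell_tags :: "(nat \<Rightarrow> nat \<Rightarrow> real) set" where
  "cell_tags = {\<xi>. \<forall>N. \<forall>i<N. \<xi> N i \<in> {real i / real N..real (i + 1) / real N}}"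

lemma cell_tags_unit:
  assumes "\<xi> \<in> cell_tags" "i < N"
  shows "\<xi> N i \<in> {0..1}"
proof -
  have "\<xi> N i \<in> {real i / real N..real (i + 1) / real N}"
    using assms by (auto simp: cell_tags_def)
  moreover have "0 \<le> real i / real N" "real (i + 1) / real N \<le> 1"
    using assms(2) by (auto simp: divide_simps)
  ultimately show ?thesis
    unfolding atLeastAtMost_iff by linarith
qed

definition uniform_division :: "(nat \<Rightarrow> real) \<Rightarrow> nat \<Rightarrow> (real \<times> real set) set" where
  "uniform_division \<xi> N = (\<lambda>i. (\<xi> i, {real i / real N..real (i + 1) / real N})) ` {..<N}"

lemma uniform_division:
  assumes N: "N > 0" and \<xi>: "\<And>i. i < N \<Longrightarrow> \<xi> i \<in> {real i / real N..real (i + 1) / real N}"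
  shows "uniform_division \<xi> N tagged_division_of {0..1}"
proof (rule tagged_division_ofI)
  show "finite (uniform_division \<xi> N)" by (simp add: uniform_division_def)
  fix x K assume "(x, K) \<in> uniform_division \<xi> N"
  then obtain i where i: "i < N" "x = \<xi> i" "K = {real i / real N..real (i + 1) / real N}"
    by (auto simp: uniform_division_def)
  show "x \<in> K" using i \<xi> by auto
  have "0 \<le> real i / real N" "real (i + 1) / real N \<le> 1"
    using i by (auto simp: divide_simps)
  then show "K \<subseteq> {0..1}" using i by auto
  show "\<exists>a b. K = cbox a b" using i(3) by (metis box_real(2))
next
  fix x1 K1 x2 K2
  assume "(x1, K1) \<in> uniform_division \<xi> N" "(x2, K2) \<in> uniform_division \<xi> N"
    and ne: "(x1, K1) \<noteq> (x2, K2)"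
  then obtain i j where ij: "x1 = \<xi> i" "K1 = {real i / real N..real (i + 1) / real N}"
     "x2 = \<xi> j" "K2 = {real j / real N..real (j + 1) / real N}" by (auto simp: uniform_division_def)
  have disj: "{real i / real N<..<real (i + 1) / real N} \<inter> {real j / real N<..<real (j + 1) / real N} = {}"
    if "i < j" for i j
  proof -
    have "real (i + 1) / real N \<le> real j / real N" using that by (intro divide_right_mono) auto
    then show ?thesis by auto
  qed
  have "i < j \<or> j < i" using ne ij by (cases i j rule: linorder_cases) auto
  then show "interior K1 \<inter> interior K2 = {}"
    unfolding ij interior_atLeastAtMost_real using disj[of i j] disj[of j i] by blast
next
  have "\<exists>i<N. x \<in> {real i / real N..real (i + 1) / real N}" if x: "0 \<le> x" "x \<le> 1" for x :: real
  \<comment> \<open>At the right end point the floor would give the index \<open>N\<close>, one too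
    many.\<close>
  proof (cases "x = 1")
    case True
    then show ?thesis using N by (intro exI[of _ "N - 1"]) (auto simp: divide_simps)
  next
    case False
    define i where "i = nat \<lfloor>x * real N\<rfloor>"
    have xN: "0 \<le> x * real N" "x * real N < real N" using x False N by auto
    then have "real i = of_int \<lfloor>x * real N\<rfloor>" by (simp add: i_def)
    then have "real i \<le> x * real N" "x * real N < real i + 1" by linarith+
    moreover from this have "i < N" using xN by linarith
    ultimately show ?thesis using N by (intro exI[of _ i]) (auto simp: divide_simps)
  qed
  then have "{0..1} \<subseteq> (\<Union>i<N. {real i / real N..real (i + 1) / real N})"
    by (intro subsetI) (simp only: UN_iff atLeastAtMost_iff lessThan_iff, blast)
  moreover have "(\<Union>i<N. {real i / real N..real (i + 1) / real N}) \<subseteq> {0..1}"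
  proof (rule UN_least)
    fix i assume "i \<in> {..<N}"
    then have "0 \<le> real i / real N" "real (i + 1) / real N \<le> 1"
      by (auto simp: divide_simps)
    then show "{real i / real N..real (i + 1) / real N} \<subseteq> {0..1}" by simp
  qed
  ultimately have "(\<Union>i<N. {real i / real N..real (i + 1) / real N}) = {0..1}" by simp
  moreover have "\<Union> {K. \<exists>x. (x, K) \<in> uniform_division \<xi> N} = (\<Union>i<N. {real i / real N..real (i + 1) / real N})"
    by (auto simp: uniform_division_def)
  ultimately show "\<Union> {K. \<exists>x. (x, K) \<in> uniform_division \<xi> N} = {0..1}"
    by simp
qed

lemma sum_uniform_division:
  fixes f :: "real \<Rightarrow> 'b::real_vector"
  assumes N: "N > 0"
  shows "(\<Sum>(x, K)\<in>uniform_division \<xi> N. measure lborel K *\<^sub>R f x) = (\<Sum>i<N. f (\<xi> i)) /\<^sub>R real N"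
proof -
  \<comment> \<open>Adjacent cells may share a tag; their intervals keep the pairs distinct, so no
    term of the sum is lost.\<close>
  have "inj_on (\<lambda>i. (\<xi> i, {real i / real N..real (i + 1) / real N})) {..<N}"
    using N by (auto simp: inj_on_def Icc_eq_Icc divide_simps)
  moreover have "real (i + 1) / real N - real i / real N = 1 / real N" for i
    by (simp add: add_divide_distrib)
  moreover have "real i / real N \<le> real (i + 1) / real N" for i
    by (simp add: divide_right_mono)
  ultimately show ?thesis
    unfolding uniform_division_def
    by (subst sum.reindex) (simp_all add: inverse_eq_divide scale_sum_right del: of_nat_add)
qed

text \<open>The limit is fixed before the tags, so Riemann sums for different tag families may be
  subtracted from each other.\<close>

lemma riemann_sums_tendsto:
  assumes "f riemann_integrable_on {0..1}"
  obtains I where "\<And>\<xi>. \<xi> \<in> cell_tags \<Longrightarrow> (\<lambda>N. (\<Sum>i<N. f (\<xi> N i)) /\<^sub>R real N) \<longlonglongrightarrow> I"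
proof -
  obtain I where I: "\<And>e. e > 0 \<Longrightarrow> \<exists>d>0. \<forall>p. p tagged_division_of {0..1} \<and> (\<forall>(x, K)\<in>p. diameter K < d) \<longrightarrow>
        norm ((\<Sum>(x, K)\<in>p. measure lborel K *\<^sub>R f x) - I) < e"
    using assms unfolding riemann_integrable_on_def by metis
  have "(\<lambda>N. (\<Sum>i<N. f (\<xi> N i)) /\<^sub>R real N) \<longlonglongrightarrow> I" if \<xi>: "\<xi> \<in> cell_tags" for \<xi>
  proof (rule LIMSEQ_I)
    fix e :: real assume "e > 0"
    then obtain d where d: "d > 0" "\<And>p. p tagged_division_of {0..1} \<Longrightarrow> (\<forall>(x, K)\<in>p. diameter K < d) \<Longrightarrow>
        norm ((\<Sum>(x, K)\<in>p. measure lborel K *\<^sub>R f x) - I) < e"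
      using I by metis
    obtain N0 where N0: "inverse (real (Suc N0)) < d"
      using reals_Archimedean[OF d(1)] by blast
    have "norm ((\<Sum>i<N. f (\<xi> N i)) /\<^sub>R real N - I) < e" if N: "N \<ge> Suc N0" for N
    proof -
      have "1 / real N < d"
        using N N0 le_imp_inverse_le[of "real (Suc N0)" "real N"] by (simp add: inverse_eq_divide)
      then have diam: "\<forall>(x, K)\<in>uniform_division (\<xi> N) N. diameter K < d"
        using N by (auto simp: uniform_division_def diff_divide_distrib[symmetric] divide_right_mono d(1))
      have "uniform_division (\<xi> N) N tagged_division_of {0..1}"
        using \<xi> N by (intro uniform_division) (auto simp: cell_tags_def)
      from d(2)[OF this diam] show ?thesis
        using sum_uniform_division[where \<xi> = "\<xi> N" and f = f] N by simp
    qed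
    then show "\<exists>no. \<forall>N\<ge>no. norm ((\<Sum>i<N. f (\<xi> N i)) /\<^sub>R real N - I) < e" by blast
  qed
  then show thesis using that by blast
qed

text \<open>Darboux's form of Riemann integrability: the mean oscillation over the cells vanishes in the limit.\<close>
definition small_osc :: "(real \<Rightarrow> complex) \<Rightarrow> bool" where
  "small_osc f \<longleftrightarrow> (\<forall>\<xi>\<in>cell_tags. \<forall>\<eta>\<in>cell_tags.
     (\<lambda>N. (\<Sum>i<N. cmod (f (\<xi> N i) - f (\<eta> N i))) / real N) \<longlonglongrightarrow> 0)"

text \<open>
  Exchanging the two tags of a cell whenever the difference of the values of \<open>h\<close> is negative turns
  the sum of the absolute differences into a difference of two Riemann sums.
\<close>
lemma riemann_integrable_imp_small_osc:
  assumes "f riemann_integrable_on {0..1}"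
  shows "small_osc f"
  unfolding small_osc_def
proof (intro ballI)
  fix \<xi> \<eta> assume \<xi>: "\<xi> \<in> cell_tags" and \<eta>: "\<eta> \<in> cell_tags"
  obtain I where I: "\<And>\<xi>. \<xi> \<in> cell_tags \<Longrightarrow> (\<lambda>N. (\<Sum>i<N. f (\<xi> N i)) /\<^sub>R real N) \<longlonglongrightarrow> I"
    using riemann_sums_tendsto[OF assms] by blast
  \<comment> \<open>Exchanging tags needs ordered values, so the argument runs for a real linear
    functional and is applied to \<open>Re\<close> and \<open>Im\<close>.\<close>
  have *: "(\<lambda>N. (\<Sum>i<N. \<bar>h (f (\<xi> N i)) - h (f (\<eta> N i))\<bar>) / real N) \<longlonglongrightarrow> 0"
    if h: "bounded_linear h" for h :: "complex \<Rightarrow> real"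
  proof -
    interpret h: bounded_linear h by (rule h)
    define u where "u N i = (if h (f (\<eta> N i)) \<le> h (f (\<xi> N i)) then \<xi> N i else \<eta> N i)" for N i
    define v where "v N i = (if h (f (\<eta> N i)) \<le> h (f (\<xi> N i)) then \<eta> N i else \<xi> N i)" for N i
    have uv: "u \<in> cell_tags" "v \<in> cell_tags"
      using \<xi> \<eta> by (auto simp: cell_tags_def u_def v_def)
    have "(\<lambda>N. h ((\<Sum>i<N. f (u N i)) /\<^sub>R real N - (\<Sum>i<N. f (v N i)) /\<^sub>R real N)) \<longlonglongrightarrow> h (I - I)"
      by (intro h.tendsto tendsto_diff I uv)
    moreover have "h ((\<Sum>i<N. f (u N i)) /\<^sub>R real N - (\<Sum>i<N. f (v N i)) /\<^sub>R real N) =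
        (\<Sum>i<N. \<bar>h (f (\<xi> N i)) - h (f (\<eta> N i))\<bar>) / real N" for N
    proof -
      have "\<bar>h (f (\<xi> N i)) - h (f (\<eta> N i))\<bar> = h (f (u N i)) - h (f (v N i))" for i
        by (auto simp: u_def v_def)
      then have eq: "(\<Sum>i<N. \<bar>h (f (\<xi> N i)) - h (f (\<eta> N i))\<bar>) = (\<Sum>i<N. h (f (u N i))) - (\<Sum>i<N. h (f (v N i)))"
        by (simp only: sum_subtractf)
      show ?thesis
        by (simp only: eq h.diff h.scaleR h.sum) (simp add: divide_inverse algebra_simps)
    qed
    ultimately show ?thesis by (simp add: h.zero)
  qed
  have "(\<lambda>N. (\<Sum>i<N. \<bar>Re (f (\<xi> N i)) - Re (f (\<eta> N i))\<bar>) / real N +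
           (\<Sum>i<N. \<bar>Im (f (\<xi> N i)) - Im (f (\<eta> N i))\<bar>) / real N) \<longlonglongrightarrow> 0 + 0"
    by (intro tendsto_add * bounded_linear_Re bounded_linear_Im)
  then have lim: "(\<lambda>N. (\<Sum>i<N. \<bar>Re (f (\<xi> N i)) - Re (f (\<eta> N i))\<bar>) / real N +
           (\<Sum>i<N. \<bar>Im (f (\<xi> N i)) - Im (f (\<eta> N i))\<bar>) / real N) \<longlonglongrightarrow> 0" by simp
  show "(\<lambda>N. (\<Sum>i<N. cmod (f (\<xi> N i) - f (\<eta> N i))) / real N) \<longlonglongrightarrow> 0"
  proof (rule tendsto_zero_sandwich[OF lim])
    fix N
    show "(\<Sum>i<N. cmod (f (\<xi> N i) - f (\<eta> N i))) / real N \<le>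
       (\<Sum>i<N. \<bar>Re (f (\<xi> N i)) - Re (f (\<eta> N i))\<bar>) / real N + (\<Sum>i<N. \<bar>Im (f (\<xi> N i)) - Im (f (\<eta> N i))\<bar>) / real N"
      unfolding add_divide_distrib[symmetric] sum.distrib[symmetric]
      by (intro divide_right_mono sum_mono)
         (auto intro: order_trans[OF cmod_le])
  qed (rule mean_nonneg, simp)
qed

section \<open>Closure properties of small mean oscillation\<close>

lemma small_osc_lipschitz:
  assumes "small_osc f"
    and "\<And>x y. x \<in> {0..1} \<Longrightarrow> y \<in> {0..1} \<Longrightarrow> cmod (g x - g y) \<le> L * cmod (f x - f y)"
  shows "small_osc g"
  unfolding small_osc_def
proof (intro ballI)
  fix \<xi> \<eta> assume t: "\<xi> \<in> cell_tags" "\<eta> \<in> cell_tags"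
  have "(\<lambda>N. L * ((\<Sum>i<N. cmod (f (\<xi> N i) - f (\<eta> N i))) / real N)) \<longlonglongrightarrow> L * 0"
    using assms(1) t by (intro tendsto_mult tendsto_const) (auto simp: small_osc_def)
  then have lim: "(\<lambda>N. L * ((\<Sum>i<N. cmod (f (\<xi> N i) - f (\<eta> N i))) / real N)) \<longlonglongrightarrow> 0" by simp
  show "(\<lambda>N. (\<Sum>i<N. cmod (g (\<xi> N i) - g (\<eta> N i))) / real N) \<longlonglongrightarrow> 0"
  proof (rule tendsto_zero_sandwich[OF lim])
    fix N
    show "(\<Sum>i<N. cmod (g (\<xi> N i) - g (\<eta> N i))) / real N
        \<le> L * ((\<Sum>i<N. cmod (f (\<xi> N i) - f (\<eta> N i))) / real N)"
      unfolding times_divide_eq_right sum_distrib_left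
      using t cell_tags_unit assms(2)
      by (intro divide_right_mono sum_mono) auto
  qed (rule mean_nonneg, simp)
qed

lemma small_osc_const: "small_osc (\<lambda>_. c)"
  by (simp add: small_osc_def)

lemma small_osc_cmult: "small_osc f \<Longrightarrow> small_osc (\<lambda>x. c * f x)"
  by (rule small_osc_lipschitz[of f _ "cmod c"]) (auto simp: norm_mult simp flip: right_diff_distrib)

lemma small_osc_add:
  assumes "small_osc f" "small_osc g"
  shows "small_osc (\<lambda>x. f x + g x)"
  unfolding small_osc_def
proof (intro ballI)
  fix \<xi> \<eta> assume t: "\<xi> \<in> cell_tags" "\<eta> \<in> cell_tags"
  have "(\<lambda>N. (\<Sum>i<N. cmod (f (\<xi> N i) - f (\<eta> N i))) / real N + (\<Sum>i<N. cmod (g (\<xi> N i) - g (\<eta> N i))) / real N)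
     \<longlonglongrightarrow> 0 + 0"
    using assms t by (intro tendsto_add) (auto simp: small_osc_def)
  then have lim: "(\<lambda>N. (\<Sum>i<N. cmod (f (\<xi> N i) - f (\<eta> N i))) / real N + (\<Sum>i<N. cmod (g (\<xi> N i) - g (\<eta> N i))) / real N)
     \<longlonglongrightarrow> 0" by simp
  show "(\<lambda>N. (\<Sum>i<N. cmod (f (\<xi> N i) + g (\<xi> N i) - (f (\<eta> N i) + g (\<eta> N i)))) / real N) \<longlonglongrightarrow> 0"
  proof (rule tendsto_zero_sandwich[OF lim])
    fix N
    show "(\<Sum>i<N. cmod (f (\<xi> N i) + g (\<xi> N i) - (f (\<eta> N i) + g (\<eta> N i)))) / real N \<le>
       (\<Sum>i<N. cmod (f (\<xi> N i) - f (\<eta> N i))) / real N + (\<Sum>i<N. cmod (g (\<xi> N i) - g (\<eta> N i))) / real N"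
      unfolding add_divide_distrib[symmetric] sum.distrib[symmetric]
      by (intro divide_right_mono sum_mono norm_diff_triangle_ineq) auto
  qed (rule mean_nonneg, simp)
qed

lemma small_osc_sum:
  assumes "finite S" "\<And>s. s \<in> S \<Longrightarrow> small_osc (f s)"
  shows "small_osc (\<lambda>x. \<Sum>s\<in>S. f s x)"
  using assms by (induction S rule: finite_induct) (auto intro: small_osc_const small_osc_add)

lemma small_osc_uniform_limit:
  assumes "\<And>e. e > 0 \<Longrightarrow> \<exists>g. small_osc g \<and> (\<forall>x\<in>{0..1}. cmod (f x - g x) \<le> e)"
  shows "small_osc f"
  unfolding small_osc_def
proof (intro ballI)
  fix \<xi> \<eta> assume t: "\<xi> \<in> cell_tags" "\<eta> \<in> cell_tags"
  show "(\<lambda>N. (\<Sum>i<N. cmod (f (\<xi> N i) - f (\<eta> N i))) / real N) \<longlonglongrightarrow> 0"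
  proof (rule LIMSEQ_I)
    fix e :: real assume e: "e > 0"
    obtain g where g: "small_osc g" "\<forall>x\<in>{0..1}. cmod (f x - g x) \<le> e / 4"
      using assms[of "e / 4"] e by auto
    have "(\<lambda>N. (\<Sum>i<N. cmod (g (\<xi> N i) - g (\<eta> N i))) / real N) \<longlonglongrightarrow> 0"
      using g(1) t by (auto simp: small_osc_def)
    from LIMSEQ_D[OF this, of "e / 4"] e obtain N0 where
      N0: "\<And>N. N \<ge> N0 \<Longrightarrow> \<bar>(\<Sum>i<N. cmod (g (\<xi> N i) - g (\<eta> N i))) / real N\<bar> < e / 4" by auto
    have "(\<Sum>i<N. cmod (f (\<xi> N i) - f (\<eta> N i))) / real N < e" if N: "N \<ge> max 1 N0" for N
    proof -
      have "cmod (f (\<xi> N i) - f (\<eta> N i)) \<le> cmod (g (\<xi> N i) - g (\<eta> N i)) + e / 2" if i: "i < N" for i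
      proof -
        have "cmod (f (\<xi> N i) - g (\<xi> N i)) \<le> e / 4" "cmod (f (\<eta> N i) - g (\<eta> N i)) \<le> e / 4"
          using g(2) cell_tags_unit[OF t(1) i] cell_tags_unit[OF t(2) i] by auto
        then show ?thesis by norm
      qed
      then have "(\<Sum>i<N. cmod (f (\<xi> N i) - f (\<eta> N i))) \<le> (\<Sum>i<N. cmod (g (\<xi> N i) - g (\<eta> N i)) + e / 2)"
        by (intro sum_mono) auto
      then have "(\<Sum>i<N. cmod (f (\<xi> N i) - f (\<eta> N i))) / real N \<le> (\<Sum>i<N. cmod (g (\<xi> N i) - g (\<eta> N i)) + e / 2) / real N"
        by (intro divide_right_mono) auto
      also have "\<dots> = (\<Sum>i<N. cmod (g (\<xi> N i) - g (\<eta> N i))) / real N + e / 2"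
        using N by (simp add: sum.distrib add_divide_distrib)
      finally show ?thesis using N0[of N] N e unfolding abs_less_iff by linarith
    qed
    then show "\<exists>no. \<forall>N\<ge>no. norm ((\<Sum>i<N. cmod (f (\<xi> N i) - f (\<eta> N i))) / real N - 0) < e"
      by (intro exI[of _ "max 1 N0"]) (auto simp: sum_nonneg)
  qed
qed

lemma poly_lipschitz_on_cball:
  fixes p :: "complex poly"
  obtains L where "L \<ge> 0" "\<And>x y. cmod x \<le> C \<Longrightarrow> cmod y \<le> C \<Longrightarrow> cmod (poly p x - poly p y) \<le> L * cmod (x - y)"
proof -
  \<comment> \<open>A bound for \<open>p\<close> is carried through the induction because
    \<open>x * p x - y * p y\<close> splits into \<open>x * (p x - p y)\<close> and
    \<open>(x - y) * p y\<close>. The sign of \<open>C\<close> is arbitrary, hence the absolute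
    values.\<close>
  have "\<exists>L\<ge>0. \<exists>B\<ge>0. (\<forall>x. cmod x \<le> C \<longrightarrow> cmod (poly p x) \<le> B) \<and>
     (\<forall>x y. cmod x \<le> C \<longrightarrow> cmod y \<le> C \<longrightarrow> cmod (poly p x - poly p y) \<le> L * cmod (x - y))"
  proof (induction p)
    case 0
    show ?case by (intro exI[of _ 0]) auto
  next
    case (pCons a p)
    then obtain L B where LB: "L \<ge> 0" "B \<ge> 0" "\<And>x. cmod x \<le> C \<Longrightarrow> cmod (poly p x) \<le> B"
      "\<And>x y. cmod x \<le> C \<Longrightarrow> cmod y \<le> C \<Longrightarrow> cmod (poly p x - poly p y) \<le> L * cmod (x - y)" by blast
    have "cmod (poly (pCons a p) x) \<le> cmod a + \<bar>C\<bar> * B" if "cmod x \<le> C" for x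
      using that LB by (auto intro!: order_trans[OF norm_triangle_ineq] mult_mono simp: norm_mult)
    moreover have "cmod (poly (pCons a p) x - poly (pCons a p) y) \<le> (\<bar>C\<bar> * L + B) * cmod (x - y)"
      if xy: "cmod x \<le> C" "cmod y \<le> C" for x y
    proof -
      have "poly (pCons a p) x - poly (pCons a p) y = x * (poly p x - poly p y) + (x - y) * poly p y"
        by (simp add: algebra_simps)
      also have "cmod \<dots> \<le> cmod x * cmod (poly p x - poly p y) + cmod (x - y) * cmod (poly p y)"
        by (metis norm_mult norm_triangle_ineq)
      also have "\<dots> \<le> \<bar>C\<bar> * (L * cmod (x - y)) + cmod (x - y) * B"
        using xy LB by (intro add_mono mult_mono) auto
      finally show ?thesis by (simp add: algebra_simps)
    qed
    ultimately show ?case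
      using LB(1,2) by (intro exI[of _ "\<bar>C\<bar> * L + B"] conjI exI[of _ "cmod a + \<bar>C\<bar> * B"]) auto
  qed
  then show thesis using that by blast
qed

lemma small_osc_poly:
  assumes "small_osc f" "\<And>x. x \<in> {0..1} \<Longrightarrow> cmod (f x) \<le> C"
  shows "small_osc (\<lambda>x. poly p (f x))"
proof -
  obtain L where "\<And>x y. cmod x \<le> C \<Longrightarrow> cmod y \<le> C \<Longrightarrow> cmod (poly p x - poly p y) \<le> L * cmod (x - y)"
    using poly_lipschitz_on_cball by metis
  then show ?thesis
    using assms(2) by (intro small_osc_lipschitz[OF assms(1), of _ L]) auto
qed

section \<open>Variation along uniform grids\<close>

definition grid_variation :: "(real \<Rightarrow> complex) \<Rightarrow> nat \<Rightarrow> nat \<Rightarrow> real" where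
  "grid_variation f M k = (\<Sum>q | q + k \<le> M. cmod (f (real (q + k) / real M) - f (real q / real M)))"

lemma finite_grid [simp]: "finite {q. q + k \<le> (M::nat)}"
  by (rule finite_subset[of _ "{..M}"]) auto

text \<open>A k-step difference telescopes into k unit steps; at each fixed position of this chain
  every unit step of the grid occurs at most once.\<close>

lemma grid_variation_le: "grid_variation f M k \<le> real k * grid_variation f M 1"
proof (induction k)
  case 0
  show ?case by (simp add: grid_variation_def)
next
  case (Suc k)
  define d where "d q = cmod (f (real (Suc q) / real M) - f (real q / real M))" for q
  have "grid_variation f M (Suc k) \<le> (\<Sum>q | q + Suc k \<le> M.
      cmod (f (real (q + k) / real M) - f (real q / real M)) + d (q + k))"
    unfolding grid_variation_def
  proof (intro sum_mono)
    fix q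
    show "cmod (f (real (q + Suc k) / real M) - f (real q / real M)) \<le>
      cmod (f (real (q + k) / real M) - f (real q / real M)) + d (q + k)"
      unfolding d_def add_Suc_right by norm
  qed
  also have "\<dots> = (\<Sum>q | q + Suc k \<le> M. cmod (f (real (q + k) / real M) - f (real q / real M)))
      + (\<Sum>q\<in>(\<lambda>q. q + k) ` {q. q + Suc k \<le> M}. d q)"
    by (simp add: sum.distrib sum.reindex)
  also have "\<dots> \<le> grid_variation f M k + (\<Sum>q | q + 1 \<le> M. d q)"
    unfolding grid_variation_def by (intro add_mono sum_mono2 finite_grid) (auto simp: d_def)
  also have "(\<Sum>q | q + 1 \<le> M. d q) = grid_variation f M 1"
    by (simp add: grid_variation_def d_def)
  finally show ?case using Suc by (simp add: algebra_simps)
qed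

text \<open>The two end points of every cell are admissible tags, so the unit steps are differences
  between two tag families.\<close>

lemma grid_variation_tendsto:
  assumes "small_osc f"
  shows "(\<lambda>M. grid_variation f M k / real M) \<longlonglongrightarrow> 0"
proof -
  have "(\<lambda>N i. real (i + 1) / real N) \<in> cell_tags" "(\<lambda>N i. real i / real N) \<in> cell_tags"
    by (auto simp: cell_tags_def divide_right_mono)
  with assms have "(\<lambda>N. (\<Sum>i<N. cmod (f (real (i + 1) / real N) - f (real i / real N))) / real N) \<longlonglongrightarrow> 0"
    unfolding small_osc_def by fast
  moreover have "{q. q + 1 \<le> M} = {..<M}" for M :: nat by auto
  ultimately have "(\<lambda>M. grid_variation f M 1 / real M) \<longlonglongrightarrow> 0"
    by (simp add: grid_variation_def)
  from tendsto_mult[OF tendsto_const this, of "real k"]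
  have lim: "(\<lambda>M. real k * (grid_variation f M 1 / real M)) \<longlonglongrightarrow> 0" by simp
  show ?thesis
  proof (rule tendsto_zero_sandwich[OF lim])
    fix M
    show "0 \<le> grid_variation f M k / real M"
      unfolding grid_variation_def by (rule mean_nonneg) simp
    show "grid_variation f M k / real M \<le> real k * (grid_variation f M 1 / real M)"
      using grid_variation_le[of f M k] by (simp add: divide_right_mono)
  qed
qed

text \<open>The entry on diagonal l of row i samples its coefficient at
  \<open>(2 i + l) / (2 N)\<close>, to be compared with the sample at \<open>i / N\<close>: this is
  s = 2. The case s = 1 compares rows i and i + l. Both points lie on the grid of mesh
  \<open>1 / (s N)\<close>, \<open>|l|\<close> steps apart.\<close>

lemma small_osc_shift:
  assumes f: "small_osc f" and s: "s > 0"
  shows "(\<lambda>N. (\<Sum>i | i < N \<and> 0 \<le> int i + l \<and> int i + l < int N.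
     cmod (f (real_of_int (int s * int i + l) / real (s * N)) - f (real i / real N))) / real N) \<longlonglongrightarrow> 0"
proof -
  let ?S = "\<lambda>N. {i. i < N \<and> 0 \<le> int i + l \<and> int i + l < int N}"
  let ?g = "\<lambda>N i. cmod (f (real_of_int (int s * int i + l) / real (s * N)) - f (real i / real N))"
  have fin: "finite (?S N)" for N by (rule finite_subset[of _ "{..<N}"]) auto
  have le: "(\<Sum>i\<in>?S N. ?g N i) \<le> grid_variation f (s * N) (nat \<bar>l\<bar>)" for N
  proof -
    let ?t = "\<lambda>q. cmod (f (real (q + nat \<bar>l\<bar>) / real (s * N)) - f (real q / real (s * N)))"
    have cancel: "real i / real N = real (s * i) / real (s * N)" for i
      using s by simp
    have upper: "int s * int i + l \<le> int s * int N" "0 \<le> int s * int i + l" if "i \<in> ?S N" for i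
    proof -
      have "int s * int i + l \<le> int s * (int i + l)" if "l \<ge> 0"
        using s that mult_right_mono[of 1 "int s" l] by (simp add: algebra_simps)
      moreover have "int s * (int i + l) \<le> int s * int N" "int s * int i \<le> int s * int N"
        "int s * int i \<ge> int i" "0 \<le> int i + l"
        using that s mult_right_mono[of 1 "int s" "int i"] by (auto intro!: mult_left_mono)
      ultimately show "int s * int i + l \<le> int s * int N" "0 \<le> int s * int i + l"
        by linarith+
    qed
    \<comment> \<open>\<open>s * i + min l 0\<close> is the left one of the two grid points, because
      \<open>grid_variation\<close> steps to the right only.\<close>
    have "(\<Sum>i\<in>?S N. ?g N i) = (\<Sum>q\<in>(\<lambda>i. nat (int s * int i + min l 0)) ` ?S N. ?t q)"
    proof (subst sum.reindex)
      show "inj_on (\<lambda>i. nat (int s * int i + min l 0)) (?S N)"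
      proof (rule inj_onI)
        fix i j assume ij: "i \<in> ?S N" "j \<in> ?S N" "nat (int s * int i + min l 0) = nat (int s * int j + min l 0)"
        moreover have "0 \<le> int s * int i + min l 0" if "i \<in> ?S N" for i
          using upper(2)[OF that] by (cases "l \<ge> 0") (auto simp: min_def)
        ultimately have "int s * int i + min l 0 = int s * int j + min l 0"
          by (meson eq_nat_nat_iff)
        then show "i = j" using s by simp
      qed
      show "(\<Sum>i\<in>?S N. ?g N i) = sum (?t \<circ> (\<lambda>i. nat (int s * int i + min l 0))) (?S N)"
      proof (rule sum.cong[OF refl])
        fix i assume i: "i \<in> ?S N"
        show "?g N i = (?t \<circ> (\<lambda>i. nat (int s * int i + min l 0))) i"
        proof (cases "l \<ge> 0")
          case True
          then have "nat (int s * int i + min l 0) = s * i" by (simp add: min_def nat_mult_distrib)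
          then show ?thesis using True by (simp add: cancel[of i] del: of_nat_mult) (simp add: algebra_simps)
        next
          case False
          then have "real (nat (int s * int i + min l 0)) = real_of_int (int s * int i + l)"
              "nat (int s * int i + min l 0) + nat \<bar>l\<bar> = s * i"
            using upper(2)[OF i] by (auto simp: min_def simp flip: of_nat_mult)
          then show ?thesis by (simp only: comp_def cancel[of i] norm_minus_commute)
        qed
      qed
    qed
    also have "\<dots> \<le> grid_variation f (s * N) (nat \<bar>l\<bar>)"
      unfolding grid_variation_def
    proof (intro sum_mono2 finite_grid subsetI)
      fix q assume "q \<in> (\<lambda>i. nat (int s * int i + min l 0)) ` ?S N"
      then obtain i where i: "i \<in> ?S N" "q = nat (int s * int i + min l 0)" by blast
      have "int s * int i \<le> int s * int N" using i by (auto intro!: mult_left_mono)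
      then have "int (q + nat \<bar>l\<bar>) \<le> int (s * N)"
        using upper[OF i(1)] i(2) by (cases "l \<ge> 0") (auto simp: min_def)
      then show "q \<in> {q. q + nat \<bar>l\<bar> \<le> s * N}"
        by (simp only: of_nat_le_iff mem_Collect_eq)
    qed auto
    finally show ?thesis .
  qed
  have "strict_mono (\<lambda>N. s * N)" using s by (auto simp: strict_mono_def)
  from LIMSEQ_subseq_LIMSEQ[OF grid_variation_tendsto[OF f, of "nat \<bar>l\<bar>"] this]
  have "(\<lambda>N. real s * (grid_variation f (s * N) (nat \<bar>l\<bar>) / real (s * N))) \<longlonglongrightarrow> real s * 0"
    by (intro tendsto_mult tendsto_const) (simp add: comp_def)
  then have lim: "(\<lambda>N. grid_variation f (s * N) (nat \<bar>l\<bar>) / real N) \<longlonglongrightarrow> 0"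
    using s by simp
  show ?thesis
    by (rule tendsto_zero_sandwich[OF lim]) (rule mean_nonneg, simp, rule divide_right_mono[OF le], simp)
qed

section \<open>Row sums, bands and the discrete Fourier transform\<close>

text \<open>Submultiplicativity of the maximal row sum, for a single row of the left factor.\<close>

lemma row_sum_mult_le:
  fixes F G :: "nat \<Rightarrow> nat \<Rightarrow> complex"
  assumes "(\<Sum>k<n. cmod (F i k)) \<le> C" "\<And>k. k < n \<Longrightarrow> (\<Sum>j<n. cmod (G k j)) \<le> B" "0 \<le> B"
  shows "(\<Sum>j<n. cmod (\<Sum>k<n. F i k * G k j)) \<le> C * B"
proof -
  have "(\<Sum>j<n. cmod (\<Sum>k<n. F i k * G k j)) \<le> (\<Sum>j<n. \<Sum>k<n. cmod (F i k) * cmod (G k j))"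
    by (intro sum_mono sum_norm_le) (simp add: norm_mult)
  also have "\<dots> = (\<Sum>k<n. cmod (F i k) * (\<Sum>j<n. cmod (G k j)))"
    by (subst sum.swap) (simp add: sum_distrib_left)
  also have "\<dots> \<le> (\<Sum>k<n. cmod (F i k) * B)"
    using assms(2) by (intro sum_mono mult_left_mono) auto
  also have "\<dots> \<le> C * B"
    using assms(1,3) by (simp add: mult_right_mono flip: sum_distrib_right)
  finally show ?thesis .
qed

text \<open>The point is the order of the quantifiers: \<open>B\<close> depends on \<open>p\<close>
  and \<open>C\<close> only, not on the order of the matrix.\<close>

lemma mat_poly_row_sum_bound:
  fixes p :: "complex poly"
  assumes "C \<ge> 0"
  obtains B where "B \<ge> 0"
    "\<And>n A i. A \<in> carrier_mat n n \<Longrightarrow> (\<And>i. i < n \<Longrightarrow> (\<Sum>j<n. cmod (A $$ (i, j))) \<le> C) \<Longrightarrow> i < n \<Longrightarrow>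
       (\<Sum>j<n. cmod (mat_poly A p $$ (i, j))) \<le> B"
proof -
  have "\<exists>B\<ge>0. \<forall>n A i. A \<in> carrier_mat n n \<longrightarrow> (\<forall>i<n. (\<Sum>j<n. cmod (A $$ (i, j))) \<le> C) \<longrightarrow> i < n \<longrightarrow>
       (\<Sum>j<n. cmod (mat_poly A p $$ (i, j))) \<le> B"
  proof (induction p)
    case 0
    show ?case by (intro exI[of _ 0]) auto
  next
    case (pCons a p)
    then obtain B where B: "B \<ge> 0" "\<And>n A i. A \<in> carrier_mat n n \<Longrightarrow> (\<forall>i<n. (\<Sum>j<n. cmod (A $$ (i, j))) \<le> C) \<Longrightarrow> i < n \<Longrightarrow>
       (\<Sum>j<n. cmod (mat_poly A p $$ (i, j))) \<le> B" by blast
    have "(\<Sum>j<n. cmod (mat_poly A (pCons a p) $$ (i, j))) \<le> cmod a + C * B"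
      if A: "A \<in> carrier_mat n n" and r: "\<forall>i<n. (\<Sum>j<n. cmod (A $$ (i, j))) \<le> C" and i: "i < n" for n A i
    proof -
      have "(\<Sum>j<n. cmod (mat_poly A (pCons a p) $$ (i, j))) \<le>
        (\<Sum>j<n. (if i = j then cmod a else 0) + cmod (\<Sum>k<n. A $$ (i, k) * mat_poly A p $$ (k, j)))"
        using mat_poly_pCons_index[OF A i] norm_triangle_ineq by (intro sum_mono) auto
      also have "\<dots> = cmod a + (\<Sum>j<n. cmod (\<Sum>k<n. A $$ (i, k) * mat_poly A p $$ (k, j)))"
        using i by (simp add: sum.distrib)
      also have "\<dots> \<le> cmod a + C * B"
        using r i B A by (intro add_left_mono row_sum_mult_le) auto
      finally show ?thesis .
    qed
    then show ?case using B(1) assms by (intro exI[of _ "cmod a + C * B"]) auto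
  qed
  then show thesis using that by blast
qed

text \<open>From \<open>A p(A) - B p(B) = A (p(A) - p(B)) + (A - B) p(B)\<close>, again with a
  constant independent of the order. It lets a truncation replace the matrix.\<close>

lemma mat_poly_row_sum_lipschitz:
  fixes p :: "complex poly"
  assumes C: "C \<ge> 0"
  obtains L where "L \<ge> 0"
    "\<And>n A B i e. A \<in> carrier_mat n n \<Longrightarrow> B \<in> carrier_mat n n \<Longrightarrow>
       (\<And>i. i < n \<Longrightarrow> (\<Sum>j<n. cmod (A $$ (i, j))) \<le> C) \<Longrightarrow> (\<And>i. i < n \<Longrightarrow> (\<Sum>j<n. cmod (B $$ (i, j))) \<le> C) \<Longrightarrow>
       (\<And>i. i < n \<Longrightarrow> (\<Sum>j<n. cmod (A $$ (i, j) - B $$ (i, j))) \<le> e) \<Longrightarrow> i < n \<Longrightarrow>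
       (\<Sum>j<n. cmod (mat_poly A p $$ (i, j) - mat_poly B p $$ (i, j))) \<le> L * e"
proof -
  let ?H = "\<lambda>n A B e. A \<in> carrier_mat n n \<and> B \<in> carrier_mat n n \<and>
       (\<forall>i<n. (\<Sum>j<n. cmod (A $$ (i, j))) \<le> C) \<and> (\<forall>i<n. (\<Sum>j<n. cmod (B $$ (i, j))) \<le> C) \<and>
       (\<forall>i<n. (\<Sum>j<n. cmod (A $$ (i, j) - B $$ (i, j))) \<le> e)"
  have "\<exists>L\<ge>0. \<forall>n A B e. ?H n A B e \<longrightarrow>
       (\<forall>i<n. (\<Sum>j<n. cmod (mat_poly A p $$ (i, j) - mat_poly B p $$ (i, j))) \<le> L * e)"
  proof (induction p)
    case 0
    show ?case by (intro exI[of _ 0]) auto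
  next
    case (pCons a p)
    then obtain L where L: "L \<ge> 0" "\<And>n A B e i. ?H n A B e \<Longrightarrow> i < n \<Longrightarrow>
       (\<Sum>j<n. cmod (mat_poly A p $$ (i, j) - mat_poly B p $$ (i, j))) \<le> L * e" by meson
    obtain D where D: "D \<ge> 0"
      "\<And>n A i. A \<in> carrier_mat n n \<Longrightarrow> (\<And>i. i < n \<Longrightarrow> (\<Sum>j<n. cmod (A $$ (i, j))) \<le> C) \<Longrightarrow> i < n \<Longrightarrow>
       (\<Sum>j<n. cmod (mat_poly A p $$ (i, j))) \<le> D"
      using mat_poly_row_sum_bound[OF C] by metis
    have "(\<Sum>j<n. cmod (mat_poly A (pCons a p) $$ (i, j) - mat_poly B (pCons a p) $$ (i, j))) \<le> (C * L + D) * e"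
      if H: "?H n A B e" and i: "i < n" for n A B e i
    proof -
      let ?X = "\<lambda>k j. mat_poly A p $$ (k, j)" and ?Y = "\<lambda>k j. mat_poly B p $$ (k, j)"
      have A: "A \<in> carrier_mat n n" and B: "B \<in> carrier_mat n n" using H by auto
      have "0 \<le> (\<Sum>j<n. cmod (A $$ (i, j) - B $$ (i, j)))" by (intro sum_nonneg) auto
      then have e: "e \<ge> 0" using H i by force
      have "(\<Sum>j<n. cmod (mat_poly A (pCons a p) $$ (i, j) - mat_poly B (pCons a p) $$ (i, j))) =
         (\<Sum>j<n. cmod ((\<Sum>k<n. A $$ (i, k) * (?X k j - ?Y k j)) + (\<Sum>k<n. (A $$ (i, k) - B $$ (i, k)) * ?Y k j)))"
        using i by (intro sum.cong arg_cong[of _ _ cmod])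
          (auto simp: mat_poly_pCons_index[OF A] mat_poly_pCons_index[OF B] sum_subtractf algebra_simps)
      also have "\<dots> \<le> (\<Sum>j<n. cmod (\<Sum>k<n. A $$ (i, k) * (?X k j - ?Y k j)) +
          cmod (\<Sum>k<n. (A $$ (i, k) - B $$ (i, k)) * ?Y k j))"
        by (intro sum_mono norm_triangle_ineq)
      also have "\<dots> = (\<Sum>j<n. cmod (\<Sum>k<n. A $$ (i, k) * (?X k j - ?Y k j))) +
          (\<Sum>j<n. cmod (\<Sum>k<n. (A $$ (i, k) - B $$ (i, k)) * ?Y k j))"
        by (rule sum.distrib)
      also have "\<dots> \<le> C * (L * e) + e * D"
      proof (intro add_mono)
        show "(\<Sum>j<n. cmod (\<Sum>k<n. A $$ (i, k) * (?X k j - ?Y k j))) \<le> C * (L * e)"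
          using H i L e by (intro row_sum_mult_le) auto
        show "(\<Sum>j<n. cmod (\<Sum>k<n. (A $$ (i, k) - B $$ (i, k)) * ?Y k j)) \<le> e * D"
          using H i D by (intro row_sum_mult_le) auto
      qed
      finally show ?thesis by (simp add: algebra_simps)
    qed
    then show ?case using L(1) D(1) C by (intro exI[of _ "C * L + D"]) auto
  qed
  then obtain L where "L \<ge> 0" "\<forall>n A B e. ?H n A B e \<longrightarrow>
       (\<forall>i<n. (\<Sum>j<n. cmod (mat_poly A p $$ (i, j) - mat_poly B p $$ (i, j))) \<le> L * e)" by blast
  then show thesis by (intro that[of L]) auto
qed

text \<open>In each row the sum of squares is at most the square of the sum, so a row-sum error r
  costs a multiple of \<open>n * r^2\<close>, which is linear in the order like the bound aimed
  at.\<close>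

lemma frob_le_frob_add_row_sums:
  assumes X: "X \<in> carrier_mat n n" and Y: "Y \<in> carrier_mat n n"
    and r: "\<And>i. i < n \<Longrightarrow> (\<Sum>j<n. cmod (X $$ (i, j) - Y $$ (i, j))) \<le> r"
  shows "frob X \<le> 2 * frob Y + 2 * real n * r\<^sup>2"
proof -
  have sq: "(cmod x)\<^sup>2 \<le> 2 * (cmod y)\<^sup>2 + 2 * (cmod (x - y))\<^sup>2" for x y
  proof -
    have "cmod x \<le> cmod y + cmod (x - y)" by norm
    then have "(cmod x)\<^sup>2 \<le> (cmod y + cmod (x - y))\<^sup>2" by (intro power_mono) auto
    also have "\<dots> \<le> 2 * (cmod y)\<^sup>2 + 2 * (cmod (x - y))\<^sup>2"
      using sum_squares_bound[of "cmod y" "cmod (x - y)"] by (simp add: power2_sum)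
    finally show ?thesis .
  qed
  have "frob X = (\<Sum>i<n. \<Sum>j<n. (cmod (X $$ (i, j)))\<^sup>2)"
    using X by (simp add: frob_def)
  also have "\<dots> \<le> (\<Sum>i<n. \<Sum>j<n. 2 * (cmod (Y $$ (i, j)))\<^sup>2 + 2 * (cmod (X $$ (i, j) - Y $$ (i, j)))\<^sup>2)"
    by (intro sum_mono sq)
  also have "\<dots> = 2 * frob Y + 2 * (\<Sum>i<n. \<Sum>j<n. (cmod (X $$ (i, j) - Y $$ (i, j)))\<^sup>2)"
    using Y by (simp add: frob_def sum.distrib sum_distrib_left)
  also have "(\<Sum>i<n. \<Sum>j<n. (cmod (X $$ (i, j) - Y $$ (i, j)))\<^sup>2) \<le> (\<Sum>i<n. r\<^sup>2)"
  proof (intro sum_mono)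
    fix i assume "i \<in> {..<n}"
    have "(\<Sum>j<n. (cmod (X $$ (i, j) - Y $$ (i, j)))\<^sup>2) \<le> (\<Sum>j<n. cmod (X $$ (i, j) - Y $$ (i, j)))\<^sup>2"
      using L2_set_le_sum[of "{..<n}" "\<lambda>j. cmod (X $$ (i, j) - Y $$ (i, j))"]
      by (intro sqrt_le_D) (simp add: L2_set_def)
    also have "\<dots> \<le> r\<^sup>2" using r[of i] \<open>i \<in> _\<close> by (intro power_mono sum_nonneg) auto
    finally show "(\<Sum>j<n. (cmod (X $$ (i, j) - Y $$ (i, j)))\<^sup>2) \<le> r\<^sup>2" .
  qed
  finally show ?thesis by simp
qed

text \<open>Every multiplication by \<open>A\<close> widens the band by at most \<open>K\<close>,
  whatever the order; this keeps the number of frequencies in the discrete Fourier transform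
  fixed.\<close>

lemma mat_poly_banded:
  fixes p :: "complex poly" and K :: nat
  obtains D :: nat where
    "\<And>n A i j. A \<in> carrier_mat n n \<Longrightarrow> (\<And>i j. i < n \<Longrightarrow> j < n \<Longrightarrow> \<bar>int i - int j\<bar> > int K \<Longrightarrow> A $$ (i, j) = 0) \<Longrightarrow>
      i < n \<Longrightarrow> j < n \<Longrightarrow> \<bar>int i - int j\<bar> > int D \<Longrightarrow> mat_poly A p $$ (i, j) = 0"
proof -
  have "\<exists>D. \<forall>n A. A \<in> carrier_mat n n \<longrightarrow> (\<forall>i<n. \<forall>j<n. \<bar>int i - int j\<bar> > int K \<longrightarrow> A $$ (i, j) = 0) \<longrightarrow>
      (\<forall>i<n. \<forall>j<n. \<bar>int i - int j\<bar> > int D \<longrightarrow> mat_poly A p $$ (i, j) = 0)"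
  proof (induction p)
    case 0
    show ?case by auto
  next
    case (pCons a p)
    then obtain D where D: "\<And>n A i j. A \<in> carrier_mat n n \<Longrightarrow> (\<forall>i<n. \<forall>j<n. \<bar>int i - int j\<bar> > int K \<longrightarrow> A $$ (i, j) = 0) \<Longrightarrow>
      i < n \<Longrightarrow> j < n \<Longrightarrow> \<bar>int i - int j\<bar> > int D \<Longrightarrow> mat_poly A p $$ (i, j) = 0" by meson
    have "mat_poly A (pCons a p) $$ (i, j) = 0"
      if A: "A \<in> carrier_mat n n" and b: "\<forall>i<n. \<forall>j<n. \<bar>int i - int j\<bar> > int K \<longrightarrow> A $$ (i, j) = 0"
        and ij: "i < n" "j < n" "\<bar>int i - int j\<bar> > int (D + K)" for n A i j
    proof -
      have "A $$ (i, k) * mat_poly A p $$ (k, j) = 0" if k: "k < n" for k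
      proof (cases "\<bar>int i - int k\<bar> > int K")
        case False
        then have "\<bar>int k - int j\<bar> > int D" using ij(3) by linarith
        then show ?thesis using D[OF A b k ij(2)] by simp
      qed (use b ij k in auto)
      then have "(\<Sum>k<n. A $$ (i, k) * mat_poly A p $$ (k, j)) = 0" by (intro sum.neutral) simp
      moreover have "i \<noteq> j" using ij(3) by auto
      ultimately show ?thesis by (simp add: mat_poly_pCons_index[OF A ij(1,2)])
    qed
    then show ?case by (intro exI[of _ "D + K"]) blast
  qed
  then show thesis using that by meson
qed

lemma sum_roots_of_unity:
  assumes "\<bar>l\<bar> < int n" "n > 0"
  shows "(\<Sum>s<n. cis (real_of_int l * (2 * pi * real s / real n))) = (if l = 0 then of_nat n else 0)"
proof (cases "l = 0")
  case False
  define z where "z = cis (real_of_int l * (2 * pi / real n))"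
  have pow: "cis (real_of_int l * (2 * pi * real s / real n)) = z ^ s" for s
    unfolding z_def Complex.DeMoivre by (simp add: mult_ac)
  have "z \<noteq> 1"
  proof
    assume "z = 1"
    then obtain m where "real_of_int l * (2 * pi / real n) = of_int m * (2 * pi)"
      unfolding z_def cis_eq_1_iff by blast
    then have "real_of_int l = of_int m * real n" using assms(2) by (simp add: field_simps)
    then have "real_of_int l = real_of_int (m * int n)" by simp
    then have "l = m * int n" by (simp only: of_int_eq_iff)
    then have "int n dvd l" by simp
    then show False using assms(1) False by (meson abs_zmult_eq_1 dvd_abs_iff linorder_not_less zdvd_imp_le zero_less_abs_iff)
  qed
  moreover have "z ^ n = 1"
    using pow[of n] assms(2) cis_multiple_2pi[of "real_of_int l"] by (simp add: mult_ac)
  ultimately have "(\<Sum>s<n. z ^ s) = 0" by (simp add: geometric_sum)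
  then show ?thesis using False by (simp only: pow if_False)
qed simp

text \<open>The number of nodes need not exceed \<open>n\<close>, only the width of the window that carries \<open>x\<close>.\<close>
lemma sum_norm_squares_eq_dft:
  fixes x :: "nat \<Rightarrow> complex"
  assumes "\<And>j. j < n \<Longrightarrow> \<bar>int i - int j\<bar> > int D \<Longrightarrow> x j = 0"
  defines "m \<equiv> 2 * D + 1"
  shows "(\<Sum>j<n. (cmod (x j))\<^sup>2) =
    (\<Sum>s<m. (cmod (\<Sum>j<n. x j * cis (2 * pi * real s / real m * (real j - real i))))\<^sup>2) / real m"
proof -
  let ?e = "\<lambda>s j. cis (2 * pi * real s / real m * (real j - real i))"
  have m: "m > 0" by (simp add: m_def)
  have "(\<Sum>s<m. complex_of_real ((cmod (\<Sum>j<n. x j * ?e s j))\<^sup>2)) =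
      (\<Sum>s<m. \<Sum>j<n. \<Sum>k<n. x j * cnj (x k) * cis (real_of_int (int j - int k) * (2 * pi * real s / real m)))"
  proof (rule sum.cong[OF refl])
    fix s
    have e: "?e s j * cnj (?e s k) = cis (real_of_int (int j - int k) * (2 * pi * real s / real m))" for j k
    proof -
      have "2 * pi * real s / real m * (real j - real i) + - (2 * pi * real s / real m * (real k - real i)) =
          real_of_int (int j - int k) * (2 * pi * real s / real m)"
        by (simp add: algebra_simps diff_divide_distrib)
      then show ?thesis by (simp only: cis_cnj cis_mult)
    qed
    have "x j * ?e s j * cnj (x k * ?e s k) = x j * cnj (x k) * (?e s j * cnj (?e s k))" for j k
      by (simp only: complex_cnj_mult mult_ac)
    then have "x j * ?e s j * cnj (x k * ?e s k) =
        x j * cnj (x k) * cis (real_of_int (int j - int k) * (2 * pi * real s / real m))" for j k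
      by (simp only: e)
    then show "complex_of_real ((cmod (\<Sum>j<n. x j * ?e s j))\<^sup>2) =
        (\<Sum>j<n. \<Sum>k<n. x j * cnj (x k) * cis (real_of_int (int j - int k) * (2 * pi * real s / real m)))"
      by (simp only: complex_norm_square cnj_sum sum_product)
  qed
  also have "\<dots> = (\<Sum>j<n. \<Sum>k<n. x j * cnj (x k) * (\<Sum>s<m. cis (real_of_int (int j - int k) * (2 * pi * real s / real m))))"
    by (simp only: sum.swap[where A = "{..<m}" and B = "{..<n}"] sum_distrib_left)
  also have "\<dots> = (\<Sum>j<n. \<Sum>k<n. if j = k then x j * cnj (x j) * of_nat m else 0)"
  proof (intro sum.cong refl)
    fix j k assume "j \<in> {..<n}" "k \<in> {..<n}"
    then have jk: "j < n" "k < n" by auto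
    show "x j * cnj (x k) * (\<Sum>s<m. cis (real_of_int (int j - int k) * (2 * pi * real s / real m))) =
        (if j = k then x j * cnj (x j) * of_nat m else 0)"
    \<comment> \<open>Two nonzero entries lie within \<open>D\<close> of i, hence within
      \<open>2 * D < m\<close> of each other, so orthogonality of the roots of unity leaves only j =
      k.\<close>
    proof (cases "x j = 0 \<or> x k = 0")
      case False
      then have "\<bar>int i - int j\<bar> \<le> int D" "\<bar>int i - int k\<bar> \<le> int D"
        using assms(1) jk by (meson not_le)+
      then have "\<bar>int j - int k\<bar> < int m" unfolding m_def by linarith
      from sum_roots_of_unity[OF this m] show ?thesis by simp
    qed auto
  qed
  also have "\<dots> = of_nat m * (\<Sum>j<n. complex_of_real ((cmod (x j))\<^sup>2))"
    by (simp add: complex_norm_square[unfolded of_real_power] sum_distrib_left mult_ac)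
  finally have "complex_of_real (\<Sum>s<m. (cmod (\<Sum>j<n. x j * ?e s j))\<^sup>2) = complex_of_real (real m * (\<Sum>j<n. (cmod (x j))\<^sup>2))"
    by simp
  then have "(\<Sum>s<m. (cmod (\<Sum>j<n. x j * ?e s j))\<^sup>2) = real m * (\<Sum>j<n. (cmod (x j))\<^sup>2)"
    by (simp only: of_real_eq_iff)
  then show ?thesis using m by simp
qed

section \<open>Matrices of absolutely summable families of coefficients\<close>

lemma norm_has_sum_le:
  fixes f :: "'a \<Rightarrow> 'b::banach"
  assumes "(f has_sum s) A" "M summable_on A" "\<And>k. k \<in> A \<Longrightarrow> norm (f k) \<le> M k"
  shows "norm s \<le> infsum M A"
proof -
  have "f abs_summable_on A"
    using assms(2,3) by (intro summable_on_comparison_test[OF assms(2)]) auto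
  then have "norm (infsum f A) \<le> infsum (\<lambda>k. norm (f k)) A" "infsum (\<lambda>k. norm (f k)) A \<le> infsum M A"
    using assms by (auto intro: norm_infsum_bound infsum_mono)
  then show ?thesis using infsumI[OF assms(1)] by simp
qed

text \<open>Substitution l = k - i from columns to diagonals; the condition on the right says that
  diagonal l meets row i inside the matrix.\<close>

lemma sum_band:
  fixes F :: "int \<Rightarrow> 'a::comm_monoid_add"
  shows "(\<Sum>k<N. if \<bar>int k - int i\<bar> \<le> int K then F (int k - int i) else 0) =
    (\<Sum>l\<in>{- int K..int K}. if 0 \<le> int i + l \<and> int i + l < int N then F l else 0)"
proof -
  have "(\<Sum>k<N. if \<bar>int k - int i\<bar> \<le> int K then F (int k - int i) else 0) =
     (\<Sum>k | k < N \<and> \<bar>int k - int i\<bar> \<le> int K. F (int k - int i))"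
    using sum.inter_filter[of "{..<N}" "\<lambda>k. F (int k - int i)" "\<lambda>k. \<bar>int k - int i\<bar> \<le> int K"] by simp
  also have "\<dots> = (\<Sum>l | l \<in> {- int K..int K} \<and> 0 \<le> int i + l \<and> int i + l < int N. F l)"
    by (rule sum.reindex_bij_witness[where i = "\<lambda>l. nat (int i + l)" and j = "\<lambda>k. int k - int i"]) auto
  also have "\<dots> = (\<Sum>l\<in>{- int K..int K}. if 0 \<le> int i + l \<and> int i + l < int N then F l else 0)"
    by (subst sum.inter_filter[symmetric]) auto
  finally show ?thesis .
qed

definition diag_sum :: "nat \<Rightarrow> int \<Rightarrow> (nat \<Rightarrow> real) \<Rightarrow> real" where
  "diag_sum N l g = (\<Sum>i | i < N \<and> 0 \<le> int i + l \<and> int i + l < int N. g i)"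

lemma sum_diag_sum:
  "(\<Sum>i<N. \<Sum>l\<in>S. if 0 \<le> int i + l \<and> int i + l < int N then g l i else 0) = (\<Sum>l\<in>S. diag_sum N l (g l))"
proof -
  have "diag_sum N l (g l) = (\<Sum>i<N. if 0 \<le> int i + l \<and> int i + l < int N then g l i else 0)" for l
    unfolding diag_sum_def
    using sum.inter_filter[of "{..<N}" "g l" "\<lambda>i. 0 \<le> int i + l \<and> int i + l < int N"] by simp
  then show ?thesis by (simp add: sum.swap[of _ S])
qed

text \<open>The boundary effect: the bound is independent of \<open>N\<close>, so these rows
  disappear in the mean.\<close>

lemma card_off_band: "card {i. i < N \<and> \<not> (0 \<le> int i + l \<and> int i + l < int N)} \<le> nat \<bar>l\<bar>"
proof (cases "l \<ge> 0")
  case True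
  then have "{i. i < N \<and> \<not> (0 \<le> int i + l \<and> int i + l < int N)} \<subseteq> {N - nat l..<N}" by auto
  from card_mono[OF _ this] show ?thesis by simp
next
  case False
  then have "{i. i < N \<and> \<not> (0 \<le> int i + l \<and> int i + l < int N)} \<subseteq> {..<nat (- l)}" by auto
  from card_mono[OF _ this] False show ?thesis by simp
qed

text \<open>\<open>kms_matrix\<close> of order \<open>N = n + 1\<close>, where
  \<open>2 * n + 2 = 2 * N\<close>, for an arbitrary coefficient family, so that truncated families
  fit.\<close>

definition symbol_matrix :: "(int \<Rightarrow> real \<Rightarrow> complex) \<Rightarrow> nat \<Rightarrow> complex mat" where
  "symbol_matrix c N = Matrix.mat N N (\<lambda>(i, j). c (int j - int i) (real (i + j) / real (2 * N)))"

lemma symbol_matrix_carrier [simp]: "symbol_matrix c N \<in> carrier_mat N N"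
  by (simp add: symbol_matrix_def)

definition truncate :: "nat \<Rightarrow> (int \<Rightarrow> real \<Rightarrow> complex) \<Rightarrow> int \<Rightarrow> real \<Rightarrow> complex" where
  "truncate K c k = (if \<bar>k\<bar> \<le> int K then c k else (\<lambda>_. 0))"

definition band_symbol :: "nat \<Rightarrow> (int \<Rightarrow> real \<Rightarrow> complex) \<Rightarrow> real \<Rightarrow> real \<Rightarrow> complex" where
  "band_symbol K c x t = (\<Sum>k\<in>{- int K..int K}. c k x * cis (real_of_int k * t))"

text \<open>The conjugate of the matrix by the diagonal unitary matrix with entries
  \<open>cis (t * k)\<close>, under which the wave of frequency t becomes the constant vector
  1.\<close>

definition twisted_matrix :: "(int \<Rightarrow> real \<Rightarrow> complex) \<Rightarrow> real \<Rightarrow> nat \<Rightarrow> nat \<Rightarrow> nat \<Rightarrow> complex" where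
  "twisted_matrix c t N i k = symbol_matrix c N $$ (i, k) * cis (t * (real k - real i))"

text \<open>The \<open>i\<close>-th entry of \<open>p(A) e\<close> divided by that of \<open>e\<close>, for the wave \<open>e\<close> of frequency \<open>t\<close>.\<close>
definition row_symbol :: "(int \<Rightarrow> real \<Rightarrow> complex) \<Rightarrow> real \<Rightarrow> complex poly \<Rightarrow> nat \<Rightarrow> nat \<Rightarrow> complex" where
  "row_symbol c t p N i =
     (\<Sum>j<N. mat_poly (symbol_matrix c N) p $$ (i, j) * cis (t * (real j - real i)))"

locale coeff_family =
  fixes c :: "int \<Rightarrow> real \<Rightarrow> complex" and M :: "int \<Rightarrow> real"
  assumes summable_M: "M summable_on UNIV"
    and norm_c_le: "x \<in> {0..1} \<Longrightarrow> cmod (c k x) \<le> M k"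
begin

definition Mtot :: real where "Mtot = infsum M UNIV"

lemma M_nonneg: "0 \<le> M k"
  using order_trans[OF norm_ge_zero norm_c_le[of 0 k]] by simp

lemma sum_M_le_Mtot: "finite S \<Longrightarrow> sum M S \<le> Mtot"
  unfolding Mtot_def using summable_M M_nonneg by (intro finite_sum_le_infsum) auto

lemma Mtot_nonneg: "0 \<le> Mtot"
  using sum_M_le_Mtot[of "{}"] by simp

lemma tail_bound:
  assumes "e > 0"
  obtains K :: nat where "\<And>S. finite S \<Longrightarrow> S \<inter> {- int K..int K} = {} \<Longrightarrow> sum M S \<le> e"
proof -
  have "(M has_sum Mtot) UNIV"
    unfolding Mtot_def using summable_M by (rule has_sum_infsum)
  then obtain F where F: "finite F" "\<bar>sum M F - Mtot\<bar> \<le> e"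
    using has_sum_finite_approximation[of M UNIV Mtot e] assms by (auto simp: dist_norm)
  obtain K where K: "\<And>k. k \<in> F \<Longrightarrow> \<bar>k\<bar> \<le> int K"
  proof -
    have "\<bar>k\<bar> \<le> int (nat (Max (insert 0 (abs ` F))))" if "k \<in> F" for k
      using Max_ge[of "insert 0 (abs ` F)" "\<bar>k\<bar>"] F(1) that by auto
    then show thesis by (rule that)
  qed
  show thesis
  proof (rule that)
    fix S assume S: "finite S" "S \<inter> {- int K..int K} = {}"
    then have "F \<inter> S = {}" using K by (force simp: abs_le_iff)
    then have "sum M F + sum M S = sum M (F \<union> S)" using F S by (simp add: sum.union_disjoint)
    also have "\<dots> \<le> Mtot" using F S by (intro sum_M_le_Mtot) auto
    finally show "sum M S \<le> e" using F(2) by linarith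
  qed
qed

text \<open>General weights serve both the symbol, where \<open>w\<close> is an exponential, and the
  discrete Fourier coefficients, where it is an average of exponentials.\<close>

lemma has_sum_tail_bound:
  assumes K: "\<And>S. finite S \<Longrightarrow> S \<inter> {- int K..int K} = {} \<Longrightarrow> sum M S \<le> e"
    and x: "x \<in> {0..1}" and w: "\<And>k. cmod (w k) \<le> 1"
    and s: "((\<lambda>k. c k x * w k) has_sum s) UNIV"
  shows "cmod (s - (\<Sum>k\<in>{- int K..int K}. c k x * w k)) \<le> e"
proof -
  let ?F = "{- int K..int K}"
  have "((\<lambda>k. c k x * w k) has_sum (s - (\<Sum>k\<in>?F. c k x * w k))) (UNIV - ?F)"
    by (rule has_sum_Diff[OF s has_sum_finite]) auto
  moreover have le: "cmod (c k x * w k) \<le> M k" for k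
    using mult_mono[OF norm_c_le[OF x] w, of k k] M_nonneg[of k] by (simp add: norm_mult)
  moreover have sM: "M summable_on (UNIV - ?F)"
    using summable_M by (rule summable_on_subset_banach) auto
  ultimately have "cmod (s - (\<Sum>k\<in>?F. c k x * w k)) \<le> infsum M (UNIV - ?F)"
    by (intro norm_has_sum_le) auto
  also have "\<dots> \<le> e"
    using sM K by (intro infsum_le_finite_sums) auto
  finally show ?thesis .
qed

lemma norm_band_symbol_le: "x \<in> {0..1} \<Longrightarrow> cmod (band_symbol K c x t) \<le> Mtot"
proof -
  assume x: "x \<in> {0..1}"
  have "cmod (band_symbol K c x t) \<le> (\<Sum>k\<in>{- int K..int K}. M k)"
    unfolding band_symbol_def using norm_c_le[OF x] by (intro sum_norm_le) (auto simp: norm_mult)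
  also have "\<dots> \<le> Mtot" by (intro sum_M_le_Mtot) auto
  finally show ?thesis .
qed

lemma coeff_family_truncate: "coeff_family (truncate K c) M"
  using summable_M norm_c_le M_nonneg by unfold_locales (auto simp: truncate_def)

lemma norm_symbol_matrix_le: "i < N \<Longrightarrow> j < N \<Longrightarrow> cmod (symbol_matrix c N $$ (i, j)) \<le> M (int j - int i)"
  by (auto simp: symbol_matrix_def divide_simps intro!: norm_c_le)

lemma row_sum_symbol_matrix_le:
  assumes "i < N"
  shows "(\<Sum>j<N. cmod (symbol_matrix c N $$ (i, j))) \<le> Mtot"
proof -
  have "(\<Sum>j<N. cmod (symbol_matrix c N $$ (i, j))) \<le> (\<Sum>j<N. M (int j - int i))"
    using assms by (intro sum_mono norm_symbol_matrix_le) auto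
  also have "\<dots> = sum M ((\<lambda>j. int j - int i) ` {..<N})"
    by (subst sum.reindex) (auto simp: inj_on_def)
  also have "\<dots> \<le> Mtot" by (intro sum_M_le_Mtot) auto
  finally show ?thesis .
qed

text \<open>Row sums control polynomials in the matrix; column sums control the mean over all rows
  of an error vector after multiplication by the matrix.\<close>

lemma col_sum_symbol_matrix_le:
  assumes "j < N"
  shows "(\<Sum>i<N. cmod (symbol_matrix c N $$ (i, j))) \<le> Mtot"
proof -
  have "(\<Sum>i<N. cmod (symbol_matrix c N $$ (i, j))) \<le> (\<Sum>i<N. M (int j - int i))"
    using assms by (intro sum_mono norm_symbol_matrix_le) auto
  also have "\<dots> = sum M ((\<lambda>i. int j - int i) ` {..<N})"
    by (subst sum.reindex) (auto simp: inj_on_def)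
  also have "\<dots> \<le> Mtot" by (intro sum_M_le_Mtot) auto
  finally show ?thesis .
qed

lemma row_sum_truncate_le:
  assumes K: "\<And>S. finite S \<Longrightarrow> S \<inter> {- int K..int K} = {} \<Longrightarrow> sum M S \<le> e" and i: "i < N"
  shows "(\<Sum>j<N. cmod (symbol_matrix c N $$ (i, j) - symbol_matrix (truncate K c) N $$ (i, j))) \<le> e"
proof -
  let ?J = "{j. j < N \<and> \<bar>int j - int i\<bar> > int K}"
  have "(\<Sum>j<N. cmod (symbol_matrix c N $$ (i, j) - symbol_matrix (truncate K c) N $$ (i, j))) \<le>
     (\<Sum>j<N. if \<bar>int j - int i\<bar> > int K then M (int j - int i) else 0)"
    using i norm_symbol_matrix_le[OF i] by (intro sum_mono) (auto simp: symbol_matrix_def truncate_def)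
  also have "\<dots> = (\<Sum>j\<in>?J. M (int j - int i))"
    using sum.inter_filter[of "{..<N}" "\<lambda>j. M (int j - int i)" "\<lambda>j. \<bar>int j - int i\<bar> > int K"] by simp
  also have "\<dots> = sum M ((\<lambda>j. int j - int i) ` ?J)"
    by (subst sum.reindex) (auto simp: inj_on_def)
  also have "\<dots> \<le> e" by (intro K) auto
  finally show ?thesis .
qed

end

section \<open>Action of banded matrices on waves\<close>

locale osc_coeff_family = coeff_family +
  assumes small_osc_c: "small_osc (c k)"
begin

lemma small_osc_band_symbol: "small_osc (\<lambda>x. band_symbol K c x t)"
  unfolding band_symbol_def mult.commute[of "c _ _"]
  by (intro small_osc_sum small_osc_cmult small_osc_c) simp

context
  fixes K :: nat and t :: real
  assumes band: "\<And>k x. \<bar>k\<bar> > int K \<Longrightarrow> c k x = 0"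
begin

abbreviation "B \<equiv> symbol_matrix c"
abbreviation "b N i \<equiv> band_symbol K c (real i / real N) t"

abbreviation "Bt \<equiv> twisted_matrix c t"
abbreviation "u \<equiv> row_symbol c t"

lemma norm_Bt: "cmod (Bt N i k) = cmod (B N $$ (i, k))"
  by (simp add: twisted_matrix_def norm_mult)

lemma Bt_eq:
  assumes "i < N" "k < N"
  shows "Bt N i k = (if \<bar>int k - int i\<bar> \<le> int K
     then c (int k - int i) (real_of_int (int 2 * int i + (int k - int i)) / real (2 * N)) * cis (real_of_int (int k - int i) * t)
     else 0)"
proof -
  have "real_of_int (int 2 * int i + (int k - int i)) = real (i + k)" by simp
  then show ?thesis
    using assms band[of "int k - int i"] by (auto simp: twisted_matrix_def symbol_matrix_def mult.commute)
qed

text \<open>\<open>row_symbol\<close> is \<open>p\<close> of the twisted matrix applied to the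
  constant vector 1, so it obeys Horner's recursion.\<close>

lemma u_pCons:
  assumes i: "i < N"
  shows "u (pCons a p) N i = a + (\<Sum>k<N. Bt N i k * u p N k)"
proof -
  let ?e = "\<lambda>i j. cis (t * (real j - real i))"
  have e: "?e i k * ?e k j = ?e i j" for k j
    by (simp add: cis_mult algebra_simps)
  have "u (pCons a p) N i = (\<Sum>j<N. (if i = j then a else 0) + (\<Sum>k<N. B N $$ (i, k) * mat_poly (B N) p $$ (k, j)) * ?e i j)"
    unfolding row_symbol_def using i
    by (intro sum.cong refl) (auto simp: mat_poly_pCons_index[OF symbol_matrix_carrier] distrib_right)
  also have "\<dots> = a + (\<Sum>j<N. \<Sum>k<N. B N $$ (i, k) * mat_poly (B N) p $$ (k, j) * ?e i j)"
    using i by (simp add: sum.distrib sum_distrib_right)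
  also have "(\<Sum>j<N. \<Sum>k<N. B N $$ (i, k) * mat_poly (B N) p $$ (k, j) * ?e i j) = (\<Sum>k<N. Bt N i k * u p N k)"
  proof -
    have "B N $$ (i, k) * mat_poly (B N) p $$ (k, j) * ?e i j = Bt N i k * (mat_poly (B N) p $$ (k, j) * ?e k j)" for k j
      unfolding twisted_matrix_def e[of k j, symmetric] by (simp only: mult_ac)
    then show ?thesis
      by (subst sum.swap) (simp only: row_symbol_def sum_distrib_left)
  qed
  finally show ?thesis .
qed

text \<open>The case of the polynomial z. In row i a diagonal l either lies inside the matrix, with
  an error from moving the sample point that \<open>small_osc_shift\<close> controls, or leaves it,
  which happens in at most \<open>|l|\<close> rows at a cost of \<open>M l\<close> each.\<close>

lemma row_symbol_tendsto: "(\<lambda>N. (\<Sum>i<N. cmod ((\<Sum>k<N. Bt N i k) - b N i)) / real N) \<longlonglongrightarrow> 0"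
proof (rule tendsto_zero_sandwich)
  let ?S = "{- int K..int K}"
  let ?d = "\<lambda>N l i. cmod (c l (real_of_int (int 2 * int i + l) / real (2 * N)) - c l (real i / real N))"
  let ?in = "\<lambda>N l i. 0 \<le> int i + l \<and> int i + l < int N"
  let ?g = "\<lambda>N. (\<Sum>l\<in>?S. diag_sum N l (?d N l) / real N + M l * real_of_int \<bar>l\<bar> / real N)"
  have "(\<lambda>N. diag_sum N l (?d N l) / real N + M l * real_of_int \<bar>l\<bar> / real N) \<longlonglongrightarrow> 0 + 0" for l
    unfolding diag_sum_def
    by (intro tendsto_add small_osc_shift small_osc_c tendsto_divide_0[OF tendsto_const]
        filterlim_at_top_imp_at_infinity filterlim_real_sequentially) auto
  then show "?g \<longlonglongrightarrow> 0" by (intro tendsto_null_sum) auto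
  fix N
  show "0 \<le> (\<Sum>i<N. cmod ((\<Sum>k<N. Bt N i k) - b N i)) / real N"
    by (intro divide_nonneg_nonneg sum_nonneg) auto
  have row: "cmod ((\<Sum>k<N. Bt N i k) - b N i) \<le> (\<Sum>l\<in>?S. (if ?in N l i then ?d N l i else 0) + (if \<not> ?in N l i then M l else 0))"
    if i: "i < N" for i
  proof -
    let ?F = "\<lambda>l. c l (real_of_int (int 2 * int i + l) / real (2 * N)) * cis (real_of_int l * t)"
    have "(\<Sum>k<N. Bt N i k) = (\<Sum>k<N. if \<bar>int k - int i\<bar> \<le> int K then ?F (int k - int i) else 0)"
      using i by (intro sum.cong refl Bt_eq) auto
    also have "\<dots> = (\<Sum>l\<in>?S. if ?in N l i then ?F l else 0)"
      by (rule sum_band)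
    finally have eq: "(\<Sum>k<N. Bt N i k) - b N i = (\<Sum>l\<in>?S. (if ?in N l i then ?F l else 0) - c l (real i / real N) * cis (real_of_int l * t))"
      by (simp add: band_symbol_def sum_subtractf)
    show ?thesis
      unfolding eq
    proof (rule sum_norm_le)
      fix l
      have "cmod (c l (real i / real N)) \<le> M l" using i by (intro norm_c_le) auto
      moreover have "cmod (?F l - c l (real i / real N) * cis (real_of_int l * t)) = ?d N l i"
        by (simp add: norm_mult flip: left_diff_distrib)
      ultimately show "cmod ((if ?in N l i then ?F l else 0) - c l (real i / real N) * cis (real_of_int l * t)) \<le>
         (if ?in N l i then ?d N l i else 0) + (if \<not> ?in N l i then M l else 0)"
        by (auto simp: norm_mult)
    qed
  qed
  let ?P = "\<lambda>i l. if ?in N l i then ?d N l i else 0" and ?R = "\<lambda>i l. if \<not> ?in N l i then M l else 0"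
  have "(\<Sum>i<N. cmod ((\<Sum>k<N. Bt N i k) - b N i)) \<le> (\<Sum>i<N. \<Sum>l\<in>?S. ?P i l + ?R i l)"
    by (rule sum_mono, rule row, simp only: lessThan_iff)
  also have "\<dots> = (\<Sum>i<N. \<Sum>l\<in>?S. ?P i l) + (\<Sum>i<N. \<Sum>l\<in>?S. ?R i l)"
    by (simp only: sum.distrib)
  finally have "(\<Sum>i<N. cmod ((\<Sum>k<N. Bt N i k) - b N i)) \<le> (\<Sum>i<N. \<Sum>l\<in>?S. ?P i l) + (\<Sum>i<N. \<Sum>l\<in>?S. ?R i l)" .
  moreover have "(\<Sum>i<N. \<Sum>l\<in>?S. ?P i l) = (\<Sum>l\<in>?S. diag_sum N l (?d N l))"
    by (rule sum_diag_sum)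
  moreover have "(\<Sum>i<N. \<Sum>l\<in>?S. ?R i l) \<le> (\<Sum>l\<in>?S. M l * real_of_int \<bar>l\<bar>)"
  proof -
    have "(\<Sum>i<N. ?R i l) \<le> M l * real_of_int \<bar>l\<bar>" for l
    proof -
      have "(\<Sum>i<N. ?R i l) = (\<Sum>i\<in>{i \<in> {..<N}. \<not> ?in N l i}. M l)"
        by (rule sum.inter_filter[symmetric]) (rule finite_lessThan)
      also have "\<dots> = M l * real (card {i. i < N \<and> \<not> ?in N l i})"
        by (simp only: sum_constant lessThan_iff mult.commute)
      also have "\<dots> \<le> M l * real_of_int \<bar>l\<bar>"
      proof (rule mult_left_mono[OF _ M_nonneg])
        have "real (card {i. i < N \<and> \<not> ?in N l i}) \<le> real (nat \<bar>l\<bar>)"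
          by (intro of_nat_mono card_off_band)
        then show "real (card {i. i < N \<and> \<not> ?in N l i}) \<le> real_of_int \<bar>l\<bar>"
          by (simp only: of_nat_nat abs_ge_zero)
      qed
      finally show ?thesis .
    qed
    then show ?thesis by (subst sum.swap) (rule sum_mono)
  qed
  ultimately have "(\<Sum>i<N. cmod ((\<Sum>k<N. Bt N i k) - b N i)) \<le>
      (\<Sum>l\<in>?S. diag_sum N l (?d N l)) + (\<Sum>l\<in>?S. M l * real_of_int \<bar>l\<bar>)"
    by linarith
  then have "(\<Sum>i<N. cmod ((\<Sum>k<N. Bt N i k) - b N i)) / real N \<le>
      ((\<Sum>l\<in>?S. diag_sum N l (?d N l)) + (\<Sum>l\<in>?S. M l * real_of_int \<bar>l\<bar>)) / real N"
    by (rule divide_right_mono) (rule of_nat_0_le_iff)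
  then show "(\<Sum>i<N. cmod ((\<Sum>k<N. Bt N i k) - b N i)) / real N \<le> ?g N"
    unfolding add_divide_distrib[symmetric] sum_divide_distrib[symmetric] sum.distrib .
qed

text \<open>Multiplication by the twisted matrix mixes neighbouring rows, so the Horner step has
  three errors: the one inherited from \<open>p\<close>, the change of \<open>p(b)\<close> between
  rows k and i of the band, and the row-sum error for the polynomial z.\<close>

lemma poly_symbol_tendsto: "(\<lambda>N. (\<Sum>i<N. cmod (u p N i - poly p (b N i))) / real N) \<longlonglongrightarrow> 0"
proof (induction p)
  case 0
  show ?case
    by (simp add: row_symbol_def mat_poly_0[OF symbol_matrix_carrier] cong: sum.cong_simp)
next
  case (pCons a p)
  let ?S = "{- int K..int K}"
  let ?q = "\<lambda>x. poly p (band_symbol K c x t)"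
  obtain L where L: "\<And>x y. cmod x \<le> Mtot \<Longrightarrow> cmod y \<le> Mtot \<Longrightarrow> cmod (poly p x - poly p y) \<le> L * cmod (x - y)"
    using poly_lipschitz_on_cball by metis
  define Q where "Q = cmod (poly p 0) + \<bar>L\<bar> * Mtot"
  have Q: "cmod (poly p x) \<le> Q" if "cmod x \<le> Mtot" for x
  proof -
    have "cmod (poly p x - poly p 0) \<le> L * cmod x" using L[of x 0] that Mtot_nonneg by simp
    also have "\<dots> \<le> \<bar>L\<bar> * Mtot" using that by (intro mult_mono) auto
    finally have "cmod (poly p x - poly p 0) \<le> \<bar>L\<bar> * Mtot" .
    then show ?thesis
      using norm_triangle_sub[of "poly p x" "poly p 0"] by (simp add: Q_def)
  qed
  have osc: "small_osc ?q"
    by (intro small_osc_poly[where C = Mtot] small_osc_band_symbol norm_band_symbol_le)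
  \<comment> \<open>The factors 1 make this an instance of \<open>small_osc_shift\<close> with s =
    1.\<close>
  let ?d = "\<lambda>N l i. cmod (?q (real_of_int (int 1 * int i + l) / real (1 * N)) - ?q (real i / real N))"
  let ?T1 = "\<lambda>N. Mtot * ((\<Sum>i<N. cmod (u p N i - poly p (b N i))) / real N)"
  let ?T2 = "\<lambda>N. \<Sum>l\<in>?S. M l * (diag_sum N l (?d N l) / real N)"
  let ?T3 = "\<lambda>N. Q * ((\<Sum>i<N. cmod ((\<Sum>k<N. Bt N i k) - b N i)) / real N)"
  show ?case
  proof (rule tendsto_zero_sandwich)
    have "(\<lambda>N. M l * (diag_sum N l (?d N l) / real N)) \<longlonglongrightarrow> M l * 0" for l
      unfolding diag_sum_def by (intro tendsto_mult tendsto_const small_osc_shift osc) auto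
    then have "?T2 \<longlonglongrightarrow> 0" by (intro tendsto_null_sum) auto
    with pCons.IH row_symbol_tendsto show "(\<lambda>N. ?T1 N + ?T2 N + ?T3 N) \<longlonglongrightarrow> 0"
      by (intro tendsto_add_zero tendsto_mult_right_zero)
    fix N
    show "0 \<le> (\<Sum>i<N. cmod (u (pCons a p) N i - poly (pCons a p) (b N i))) / real N"
      by (intro divide_nonneg_nonneg sum_nonneg) auto
    have unit: "real i / real N \<in> {0..1}" if "i < N" for i using that by auto
    let ?X1 = "\<lambda>i. \<Sum>k<N. cmod (B N $$ (i, k)) * cmod (u p N k - poly p (b N k))"
    let ?X2 = "\<lambda>i. \<Sum>k<N. cmod (Bt N i k) * cmod (poly p (b N k) - poly p (b N i))"
    let ?X3 = "\<lambda>i. cmod ((\<Sum>k<N. Bt N i k) - b N i) * Q"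
    have "cmod (u (pCons a p) N i - poly (pCons a p) (b N i)) \<le> ?X1 i + ?X2 i + ?X3 i" if i: "i < N" for i
    proof -
      define X where "X = (\<Sum>k<N. Bt N i k * (u p N k - poly p (b N k)))"
      define Y where "Y = (\<Sum>k<N. Bt N i k * (poly p (b N k) - poly p (b N i)))"
      define Z where "Z = ((\<Sum>k<N. Bt N i k) - b N i) * poly p (b N i)"
      have "(\<Sum>k<N. Bt N i k * u p N k) = X + Y + (\<Sum>k<N. Bt N i k) * poly p (b N i)"
        unfolding X_def Y_def sum_distrib_right sum.distrib[symmetric]
        by (intro sum.cong refl) (simp add: right_diff_distrib)
      then have "u (pCons a p) N i - poly (pCons a p) (b N i) = X + Y + Z"
        by (simp add: u_pCons[OF i] Z_def left_diff_distrib)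
      then have "cmod (u (pCons a p) N i - poly (pCons a p) (b N i)) \<le> cmod X + cmod Y + cmod Z"
        using norm_triangle_ineq[of "X + Y" Z] norm_triangle_ineq[of X Y] by simp
      moreover have "cmod X \<le> ?X1 i"
        unfolding X_def by (intro sum_norm_le) (simp only: norm_mult norm_Bt order_refl)
      moreover have "cmod Y \<le> ?X2 i"
        unfolding Y_def by (intro sum_norm_le) (simp only: norm_mult order_refl)
      moreover have "cmod Z \<le> ?X3 i"
        unfolding Z_def norm_mult using Q[OF norm_band_symbol_le[OF unit[OF i]]] by (intro mult_left_mono) auto
      ultimately show ?thesis by linarith
    qed
    then have "(\<Sum>i<N. cmod (u (pCons a p) N i - poly (pCons a p) (b N i))) \<le> (\<Sum>i<N. ?X1 i + ?X2 i + ?X3 i)"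
      by (intro sum_mono) simp
    moreover have "(\<Sum>i<N. ?X1 i + ?X2 i + ?X3 i) = (\<Sum>i<N. ?X1 i) + (\<Sum>i<N. ?X2 i) + (\<Sum>i<N. ?X3 i)"
      by (simp only: sum.distrib)
    \<comment> \<open>Exchanging the sums produces column sums, so the inherited mean error is
      merely multiplied by \<open>Mtot\<close>.\<close>
    moreover have "(\<Sum>i<N. ?X1 i) \<le> Mtot * (\<Sum>k<N. cmod (u p N k - poly p (b N k)))"
    proof -
      have "(\<Sum>i<N. ?X1 i) = (\<Sum>k<N. (\<Sum>i<N. cmod (B N $$ (i, k))) * cmod (u p N k - poly p (b N k)))"
        by (subst sum.swap) (simp only: sum_distrib_right)
      also have "\<dots> \<le> (\<Sum>k<N. Mtot * cmod (u p N k - poly p (b N k)))"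
        by (intro sum_mono mult_right_mono col_sum_symbol_matrix_le) auto
      finally show ?thesis by (simp only: sum_distrib_left)
    qed
    moreover have "(\<Sum>i<N. ?X2 i) \<le> (\<Sum>l\<in>?S. M l * diag_sum N l (?d N l))"
    proof -
      have "?X2 i \<le> (\<Sum>l\<in>?S. if 0 \<le> int i + l \<and> int i + l < int N then M l * ?d N l i else 0)"
        if i: "i < N" for i
      proof -
        have "?X2 i \<le> (\<Sum>k<N. if \<bar>int k - int i\<bar> \<le> int K then M (int k - int i) * ?d N (int k - int i) i else 0)"
        proof (intro sum_mono)
          fix k assume "k \<in> {..<N}"
          then have k: "k < N" by simp
          have arg: "real_of_int (int 1 * int i + (int k - int i)) / real (1 * N) = real k / real N" by simp
          have "cmod (Bt N i k) = 0" if "\<not> \<bar>int k - int i\<bar> \<le> int K"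
            unfolding Bt_eq[OF i k] if_not_P[OF that] by simp
          moreover have "cmod (Bt N i k) \<le> M (int k - int i)"
            unfolding norm_Bt by (rule norm_symbol_matrix_le[OF i k])
          ultimately show "cmod (Bt N i k) * cmod (poly p (b N k) - poly p (b N i)) \<le>
              (if \<bar>int k - int i\<bar> \<le> int K then M (int k - int i) * ?d N (int k - int i) i else 0)"
            unfolding arg by (cases "\<bar>int k - int i\<bar> \<le> int K") (simp_all add: mult_right_mono)
        qed
        also have "\<dots> = (\<Sum>l\<in>?S. if 0 \<le> int i + l \<and> int i + l < int N then M l * ?d N l i else 0)"
          by (rule sum_band)
        finally show ?thesis .
      qed
      then have "(\<Sum>i<N. ?X2 i) \<le> (\<Sum>i<N. \<Sum>l\<in>?S. if 0 \<le> int i + l \<and> int i + l < int N then M l * ?d N l i else 0)"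
        by (intro sum_mono) simp
      also have "\<dots> = (\<Sum>l\<in>?S. diag_sum N l (\<lambda>i. M l * ?d N l i))"
        by (rule sum_diag_sum)
      also have "\<dots> = (\<Sum>l\<in>?S. M l * diag_sum N l (?d N l))"
        by (simp only: diag_sum_def sum_distrib_left)
      finally show ?thesis .
    qed
    moreover have "(\<Sum>i<N. ?X3 i) = Q * (\<Sum>i<N. cmod ((\<Sum>k<N. Bt N i k) - b N i))"
      by (simp only: sum_distrib_left mult.commute)
    ultimately have "(\<Sum>i<N. cmod (u (pCons a p) N i - poly (pCons a p) (b N i))) \<le>
      Mtot * (\<Sum>k<N. cmod (u p N k - poly p (b N k))) + (\<Sum>l\<in>?S. M l * diag_sum N l (?d N l))
        + Q * (\<Sum>i<N. cmod ((\<Sum>k<N. Bt N i k) - b N i))"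
      by linarith
    then have "(\<Sum>i<N. cmod (u (pCons a p) N i - poly (pCons a p) (b N i))) / real N \<le>
      (Mtot * (\<Sum>k<N. cmod (u p N k - poly p (b N k))) + (\<Sum>l\<in>?S. M l * diag_sum N l (?d N l))
        + Q * (\<Sum>i<N. cmod ((\<Sum>k<N. Bt N i k) - b N i))) / real N"
      by (rule divide_right_mono) simp
    then show "(\<Sum>i<N. cmod (u (pCons a p) N i - poly (pCons a p) (b N i))) / real N \<le> ?T1 N + ?T2 N + ?T3 N"
      unfolding times_divide_eq_right sum_divide_distrib[symmetric] add_divide_distrib[symmetric] .
  qed
qed

end

end

lemma has_sum_finite_sum:
  fixes f :: "'x \<Rightarrow> 'y \<Rightarrow> 'z::topological_comm_monoid_add"
  assumes "finite S" "\<And>s. s \<in> S \<Longrightarrow> (f s has_sum g s) A"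
  shows "((\<lambda>x. \<Sum>s\<in>S. f s x) has_sum (\<Sum>s\<in>S. g s)) A"
  using assms by (induction S rule: finite_induct) (auto intro: has_sum_add)

context osc_coeff_family
begin

text \<open>The mean errors are of first order; the uniform bound \<open>R\<close> on
  \<open>row_symbol\<close> upgrades them to squares. Smallness of the symbol is known only at the
  tags, and small oscillation carries it to the grid points \<open>i / N\<close>. In the constant 5,
  the square of \<open>2 * d\<close> accounts for 4 and the vanishing errors for 1.\<close>

lemma sum_norm_squares_row_symbol:
  assumes band: "\<And>k x. \<bar>k\<bar> > int K \<Longrightarrow> c k x = 0"
    and d: "0 < d" and \<xi>: "\<xi> \<in> cell_tags"
    and small: "\<And>N i. i < N \<Longrightarrow> cmod (poly p (band_symbol K c (\<xi> N i) t)) \<le> 2 * d"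
  shows "\<forall>\<^sub>F N in sequentially. (\<Sum>i<N. (cmod (row_symbol c t p N i))\<^sup>2) \<le> 5 * d\<^sup>2 * real N"
proof -
  let ?q = "\<lambda>x. poly p (band_symbol K c x t)"
  obtain R where R: "R \<ge> 0"
    "\<And>n A i. A \<in> carrier_mat n n \<Longrightarrow> (\<And>i. i < n \<Longrightarrow> (\<Sum>j<n. cmod (A $$ (i, j))) \<le> Mtot) \<Longrightarrow> i < n \<Longrightarrow>
       (\<Sum>j<n. cmod (mat_poly A p $$ (i, j))) \<le> R"
    using mat_poly_row_sum_bound[OF Mtot_nonneg] by metis
  have uR: "cmod (row_symbol c t p N i) \<le> R" if "i < N" for N i
  proof -
    have "cmod (row_symbol c t p N i) \<le> (\<Sum>j<N. cmod (mat_poly (symbol_matrix c N) p $$ (i, j)))"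
      unfolding row_symbol_def by (intro sum_norm_le) (simp add: norm_mult)
    also have "\<dots> \<le> R" using that row_sum_symbol_matrix_le by (intro R) auto
    finally show ?thesis .
  qed
  define w1 where "w1 N i = cmod (row_symbol c t p N i - ?q (real i / real N))" for N i
  define w2 where "w2 N i = cmod (?q (real i / real N) - ?q (\<xi> N i))" for N i
  have osc: "small_osc ?q"
    by (intro small_osc_poly[where C = Mtot] small_osc_band_symbol norm_band_symbol_le)
  have "(\<lambda>N i. real i / real N) \<in> cell_tags" by (auto simp: cell_tags_def divide_right_mono)
  with osc \<xi> have "(\<lambda>N. (\<Sum>i<N. w2 N i) / real N) \<longlonglongrightarrow> 0"
    unfolding small_osc_def w2_def by fast
  moreover have "(\<lambda>N. (\<Sum>i<N. w1 N i) / real N) \<longlonglongrightarrow> 0"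
    unfolding w1_def by (rule poly_symbol_tendsto[OF band])
  ultimately have "(\<lambda>N. (R + 2 * d) * ((\<Sum>i<N. w1 N i) / real N + (\<Sum>i<N. w2 N i) / real N)) \<longlonglongrightarrow> (R + 2 * d) * (0 + 0)"
    by (intro tendsto_intros)
  then have "\<forall>\<^sub>F N in sequentially. (R + 2 * d) * ((\<Sum>i<N. w1 N i) / real N + (\<Sum>i<N. w2 N i) / real N) < d\<^sup>2"
    using d by (intro order_tendstoD(2)[where y = "(R + 2 * d) * (0 + 0)"]) auto
  then show ?thesis
    using eventually_gt_at_top[of 0]
  proof eventually_elim
    case (elim N)
    have sq: "(cmod (row_symbol c t p N i))\<^sup>2 \<le> (R + 2 * d) * (w1 N i + w2 N i) + 4 * d\<^sup>2" if i: "i < N" for i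
    proof -
      let ?w = "w1 N i + w2 N i"
      have w: "?w \<ge> 0" by (simp add: w1_def w2_def)
      have le: "cmod (row_symbol c t p N i) \<le> ?w + 2 * d"
        using small[OF i] unfolding w1_def w2_def by norm
      have "(cmod (row_symbol c t p N i))\<^sup>2 \<le> cmod (row_symbol c t p N i) * (?w + 2 * d)"
        unfolding power2_eq_square by (intro mult_left_mono le) auto
      also have "\<dots> = cmod (row_symbol c t p N i) * ?w + cmod (row_symbol c t p N i) * (2 * d)" by (simp add: distrib_left)
      also have "\<dots> \<le> R * ?w + (?w + 2 * d) * (2 * d)"
        using uR[OF i] le w d by (intro add_mono mult_right_mono) auto
      finally show ?thesis by (simp add: algebra_simps power2_eq_square)
    qed
    have "(\<Sum>i<N. (cmod (row_symbol c t p N i))\<^sup>2) \<le> (\<Sum>i<N. (R + 2 * d) * (w1 N i + w2 N i) + 4 * d\<^sup>2)"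
      by (intro sum_mono sq) auto
    also have "\<dots> = ((R + 2 * d) * ((\<Sum>i<N. w1 N i) / real N + (\<Sum>i<N. w2 N i) / real N) + 4 * d\<^sup>2) * real N"
      using elim(2) by (simp add: sum.distrib sum_distrib_left[symmetric] field_simps)
    also have "\<dots> \<le> (d\<^sup>2 + 4 * d\<^sup>2) * real N"
      using elim(1) by (intro mult_right_mono) auto
    finally show ?case by simp
  qed
qed

end

section \<open>From the symbol to the Frobenius bound\<close>

locale fourier_family = coeff_family +
  fixes a :: "real \<Rightarrow> real \<Rightarrow> complex"
  assumes has_sum_a: "x \<in> {0..1} \<Longrightarrow> t \<in> {0..2 * pi} \<Longrightarrow> ((\<lambda>k. c k x * cis (real_of_int k * t)) has_sum a x t) UNIV"
    and riemann_a: "t \<in> {0..2 * pi} \<Longrightarrow> (\<lambda>x. a x t) riemann_integrable_on {0..1}"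
begin

lemma norm_a_minus_band_symbol_le:
  assumes K: "\<And>S. finite S \<Longrightarrow> S \<inter> {- int K..int K} = {} \<Longrightarrow> sum M S \<le> e"
    and x: "x \<in> {0..1}" and t: "t \<in> {0..2 * pi}"
  shows "cmod (a x t - band_symbol K c x t) \<le> e"
  unfolding band_symbol_def by (rule has_sum_tail_bound[OF K x _ has_sum_a[OF x t]]) auto

lemma norm_a_le:
  assumes x: "x \<in> {0..1}" and t: "t \<in> {0..2 * pi}"
  shows "cmod (a x t) \<le> Mtot"
proof (rule field_le_epsilon)
  fix e :: real assume "e > 0"
  obtain K where K: "\<And>S. finite S \<Longrightarrow> S \<inter> {- int K..int K} = {} \<Longrightarrow> sum M S \<le> e"
    using tail_bound[OF \<open>e > 0\<close>] by metis
  show "cmod (a x t) \<le> Mtot + e"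
    using norm_a_minus_band_symbol_le[where K = K and e = e, OF K x t] norm_band_symbol_le[OF x, of K t]
      norm_triangle_sub[of "a x t" "band_symbol K c x t"] by linarith
qed

text \<open>
  The discrete Fourier coefficient \<open>1/n \<Sum>s<n. a x (2 \<pi> s / n) e^(-2 \<pi> i k s / n)\<close> equals
  \<open>\<Sum>m. c (k + n m) x\<close>, so it approximates \<open>c k x\<close> uniformly in \<open>x\<close>.
\<close>
lemma small_osc_coeff: "small_osc (c k)"
proof (rule small_osc_uniform_limit)
  fix e :: real assume "e > 0"
  then obtain K0 where K0: "\<And>S. finite S \<Longrightarrow> S \<inter> {- int K0..int K0} = {} \<Longrightarrow> sum M S \<le> e"
    using tail_bound by metis
  define K where "K = max K0 (nat \<bar>k\<bar>)"
  have "K0 \<le> K" "\<bar>k\<bar> \<le> int K" by (auto simp: K_def)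
  then have K0K: "{- int K0..int K0} \<subseteq> {- int K..int K}" and kK: "k \<in> {- int K..int K}" by auto
  have K: "sum M S \<le> e" if "finite S" "S \<inter> {- int K..int K} = {}" for S
    using that K0K by (intro K0) blast+
  \<comment> \<open>For m and k in \<open>{- K..K}\<close> the difference is at most
    \<open>2 * K < n\<close> in modulus, so no two of these coefficients are aliased.\<close>
  define n where "n = 2 * K + 1"
  define \<tau> where "\<tau> s = 2 * pi * real s / real n" for s
  have n: "n > 0" by (simp add: n_def)
  have \<tau>: "\<tau> s \<in> {0..2 * pi}" if "s < n" for s
    using that by (auto simp: \<tau>_def divide_simps)
  define g where "g x = (\<Sum>s<n. cis (- real_of_int k * \<tau> s) / of_nat n * a x (\<tau> s))" for x
  \<comment> \<open>The weight of \<open>c m\<close> in \<open>g\<close>; the aliases of k beyond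
    \<open>K\<close> go into the tail, as the weights have modulus at most 1.\<close>
  define w where "w m = (\<Sum>s<n. cis (real_of_int (m - k) * \<tau> s)) / of_nat n" for m
  have w1: "cmod (w m) \<le> 1" for m
  proof -
    have "cmod (\<Sum>s<n. cis (real_of_int (m - k) * \<tau> s)) \<le> (\<Sum>s<n. 1)"
      by (intro sum_norm_le) auto
    then show ?thesis using n by (simp add: w_def norm_divide)
  qed
  have w0: "w m = (if m = k then 1 else 0)" if "m \<in> {- int K..int K}" for m
  proof -
    have "\<bar>m - k\<bar> < int n" using that kK by (auto simp: n_def)
    from sum_roots_of_unity[OF this n] show ?thesis
      using n by (simp add: w_def \<tau>_def)
  qed
  have "cmod (c k x - g x) \<le> e" if x: "x \<in> {0..1}" for x
  proof -
    have "((\<lambda>m. \<Sum>s<n. cis (- real_of_int k * \<tau> s) / of_nat n * (c m x * cis (real_of_int m * \<tau> s))) has_sum g x) UNIV"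
      unfolding g_def using x \<tau> by (intro has_sum_finite_sum has_sum_cmult_right has_sum_a) auto
    moreover have "(\<Sum>s<n. cis (- real_of_int k * \<tau> s) / of_nat n * (c m x * cis (real_of_int m * \<tau> s))) = c m x * w m" for m
    proof -
      have "cis (- real_of_int k * \<tau> s) * cis (real_of_int m * \<tau> s) = cis (real_of_int (m - k) * \<tau> s)" for s
        by (simp add: cis_mult algebra_simps)
      then have "cis (- real_of_int k * \<tau> s) / of_nat n * (c m x * cis (real_of_int m * \<tau> s)) = c m x * (cis (real_of_int (m - k) * \<tau> s) / of_nat n)" for s
        by (metis (no_types, lifting) mult.assoc mult.commute times_divide_eq_right)
      then show ?thesis by (simp only: w_def sum_distrib_left sum_divide_distrib)
    qed
    ultimately have hs: "((\<lambda>m. c m x * w m) has_sum g x) UNIV" by simp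
    have le: "cmod (g x - (\<Sum>m\<in>{- int K..int K}. c m x * w m)) \<le> e"
      by (rule has_sum_tail_bound[where K = K and e = e, OF _ x w1 hs]) (rule K)
    have "(\<Sum>m\<in>{- int K..int K}. c m x * w m) = (\<Sum>m\<in>{- int K..int K}. if m = k then c k x else 0)"
      by (intro sum.cong refl) (auto simp: w0)
    also have "\<dots> = c k x" using kK by simp
    finally show ?thesis using le by (simp add: norm_minus_commute)
  qed
  moreover have "small_osc g"
    unfolding g_def
    by (intro small_osc_sum small_osc_cmult riemann_integrable_imp_small_osc riemann_a \<tau>) auto
  ultimately show "\<exists>g. small_osc g \<and> (\<forall>x\<in>{0..1}. cmod (c k x - g x) \<le> e)" by blast
qed

text \<open>The bound is proved for a banded truncation and then transferred. The \<open>m\<close>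
  frequencies are fixed before N, so the finitely many eventual statements, each with its own tags,
  can be combined.\<close>

lemma frob_mat_poly_eventually_le:
  fixes p :: "complex poly"
  assumes d: "0 < d"
    and tags: "\<And>t. t \<in> {0..2 * pi} \<Longrightarrow> \<exists>\<xi>\<in>cell_tags. \<forall>N. \<forall>i<N. cmod (poly p (a (\<xi> N i) t)) \<le> d"
  shows "\<forall>\<^sub>F N in sequentially. frob (mat_poly (symbol_matrix c N) p) \<le> 12 * d\<^sup>2 * real N"
proof -
  obtain L where L: "L \<ge> 0"
    "\<And>x y. cmod x \<le> Mtot \<Longrightarrow> cmod y \<le> Mtot \<Longrightarrow> cmod (poly p x - poly p y) \<le> L * cmod (x - y)"
    using poly_lipschitz_on_cball by metis
  obtain L' where L': "L' \<ge> 0"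
    "\<And>n A B i e. A \<in> carrier_mat n n \<Longrightarrow> B \<in> carrier_mat n n \<Longrightarrow>
       (\<And>i. i < n \<Longrightarrow> (\<Sum>j<n. cmod (A $$ (i, j))) \<le> Mtot) \<Longrightarrow> (\<And>i. i < n \<Longrightarrow> (\<Sum>j<n. cmod (B $$ (i, j))) \<le> Mtot) \<Longrightarrow>
       (\<And>i. i < n \<Longrightarrow> (\<Sum>j<n. cmod (A $$ (i, j) - B $$ (i, j))) \<le> e) \<Longrightarrow> i < n \<Longrightarrow>
       (\<Sum>j<n. cmod (mat_poly A p $$ (i, j) - mat_poly B p $$ (i, j))) \<le> L' * e"
    using mat_poly_row_sum_lipschitz[OF Mtot_nonneg, of p] by blast
  \<comment> \<open>Truncation then changes both the values of \<open>p\<close> on the symbol and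
    the row sums of \<open>p\<close> of the matrix by at most \<open>d\<close>; the added 1 keeps
    the denominator positive.\<close>
  define e where "e = d / (L + L' + 1)"
  have e: "e > 0" "L * e \<le> d" "L' * e \<le> d"
    using d L(1) L'(1) by (auto simp: e_def divide_simps mult_right_mono)
  obtain K where K: "\<And>S. finite S \<Longrightarrow> S \<inter> {- int K..int K} = {} \<Longrightarrow> sum M S \<le> e"
    using tail_bound[OF e(1)] by metis
  define c' where "c' = truncate K c"
  interpret T: coeff_family c' M unfolding c'_def by (rule coeff_family_truncate)
  interpret T: osc_coeff_family c' M
    using small_osc_coeff by unfold_locales (auto simp: c'_def truncate_def small_osc_const)
  have band: "c' k x = 0" if "\<bar>k\<bar> > int K" for k x
    using that by (simp add: c'_def truncate_def)
  have bs: "band_symbol K c' = band_symbol K c"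
    by (intro ext) (auto simp: band_symbol_def c'_def truncate_def intro!: sum.cong)
  let ?A = "symbol_matrix c" and ?B = "symbol_matrix c'"
  obtain D where D: "\<And>n A i j. A \<in> carrier_mat n n \<Longrightarrow>
      (\<And>i j. i < n \<Longrightarrow> j < n \<Longrightarrow> \<bar>int i - int j\<bar> > int K \<Longrightarrow> A $$ (i, j) = 0) \<Longrightarrow>
      i < n \<Longrightarrow> j < n \<Longrightarrow> \<bar>int i - int j\<bar> > int D \<Longrightarrow> mat_poly A p $$ (i, j) = 0"
    using mat_poly_banded[of K p] by blast
  define m where "m = 2 * D + 1"
  define \<tau> where "\<tau> s = 2 * pi * real s / real m" for s
  have \<tau>: "\<tau> s \<in> {0..2 * pi}" if "s < m" for s
    using that by (auto simp: \<tau>_def divide_simps)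
  have "\<forall>\<^sub>F N in sequentially. (\<Sum>i<N. (cmod (row_symbol c' (\<tau> s) p N i))\<^sup>2) \<le> 5 * d\<^sup>2 * real N" if s: "s < m" for s
  proof -
    obtain \<xi> where \<xi>: "\<xi> \<in> cell_tags" "\<And>N i. i < N \<Longrightarrow> cmod (poly p (a (\<xi> N i) (\<tau> s))) \<le> d"
      using tags[OF \<tau>[OF s]] by blast
    have "cmod (poly p (band_symbol K c' (\<xi> N i) (\<tau> s))) \<le> 2 * d" if i: "i < N" for N i
    proof -
      note x = cell_tags_unit[OF \<xi>(1) i]
      have "cmod (poly p (a (\<xi> N i) (\<tau> s)) - poly p (band_symbol K c (\<xi> N i) (\<tau> s))) \<le>
         L * cmod (a (\<xi> N i) (\<tau> s) - band_symbol K c (\<xi> N i) (\<tau> s))"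
        by (intro L(2) norm_a_le norm_band_symbol_le x \<tau>[OF s])
      also have "\<dots> \<le> L * e"
        by (intro mult_left_mono norm_a_minus_band_symbol_le K x \<tau>[OF s] L(1))
      finally show ?thesis
        using e(2) \<xi>(2)[OF i]
          norm_triangle_sub[of "poly p (band_symbol K c (\<xi> N i) (\<tau> s))" "poly p (a (\<xi> N i) (\<tau> s))"]
        unfolding bs by (simp add: norm_minus_commute)
    qed
    with band d \<xi>(1) show ?thesis by (intro T.sum_norm_squares_row_symbol) auto
  qed
  then have "\<forall>\<^sub>F N in sequentially. \<forall>s\<in>{..<m}. (\<Sum>i<N. (cmod (row_symbol c' (\<tau> s) p N i))\<^sup>2) \<le> 5 * d\<^sup>2 * real N"
    by (intro eventually_ball_finite) auto
  then show ?thesis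
  proof eventually_elim
    case (elim N)
    have "frob (mat_poly (?B N) p) = (\<Sum>i<N. \<Sum>j<N. (cmod (mat_poly (?B N) p $$ (i, j)))\<^sup>2)"
      using carrier_matD[OF mat_poly_carrier[OF symbol_matrix_carrier[of c' N], of p]] by (simp add: frob_def)
    also have "\<dots> = (\<Sum>i<N. (\<Sum>s<m. (cmod (row_symbol c' (\<tau> s) p N i))\<^sup>2) / real m)"
    proof (intro sum.cong refl)
      fix i assume "i \<in> {..<N}"
      then have "mat_poly (?B N) p $$ (i, j) = 0" if "j < N" "\<bar>int i - int j\<bar> > int D" for j
        using that band
        by (intro D[OF symbol_matrix_carrier]) (auto simp: symbol_matrix_def abs_minus_commute)
      from sum_norm_squares_eq_dft[OF this]
      show "(\<Sum>j<N. (cmod (mat_poly (?B N) p $$ (i, j)))\<^sup>2) = (\<Sum>s<m. (cmod (row_symbol c' (\<tau> s) p N i))\<^sup>2) / real m"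
        by (simp add: row_symbol_def m_def \<tau>_def)
    qed
    also have "\<dots> = (\<Sum>s<m. \<Sum>i<N. (cmod (row_symbol c' (\<tau> s) p N i))\<^sup>2) / real m"
      by (simp add: sum.swap[of _ "{..<m}"] flip: sum_divide_distrib)
    also have "\<dots> \<le> (\<Sum>s<m. 5 * d\<^sup>2 * real N) / real m"
      using elim by (intro divide_right_mono sum_mono) auto
    also have "\<dots> = 5 * d\<^sup>2 * real N" by (simp add: m_def)
    finally have B: "frob (mat_poly (?B N) p) \<le> 5 * d\<^sup>2 * real N" .
    have A: "frob (mat_poly (?A N) p) \<le> 2 * frob (mat_poly (?B N) p) + 2 * real N * (L' * e)\<^sup>2"
    proof (rule frob_le_frob_add_row_sums)
      fix i assume i: "i < N"
      have tr: "(\<Sum>j<N. cmod (?A N $$ (i, j) - ?B N $$ (i, j))) \<le> e" if "i < N" for i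
        unfolding c'_def by (rule row_sum_truncate_le[where K = K and e = e, OF K that])
      show "(\<Sum>j<N. cmod (mat_poly (?A N) p $$ (i, j) - mat_poly (?B N) p $$ (i, j))) \<le> L' * e"
        by (rule L'(2)[OF symbol_matrix_carrier symbol_matrix_carrier _ _ tr i])
          (simp_all only: row_sum_symbol_matrix_le T.row_sum_symbol_matrix_le)
    qed simp_all
    have "(L' * e)\<^sup>2 \<le> d\<^sup>2"
      using e L'(1) by (intro power_mono) auto
    then have "2 * real N * (L' * e)\<^sup>2 \<le> 2 * real N * d\<^sup>2"
      by (intro mult_left_mono) auto
    \<comment> \<open>\<open>12 = 2 * 5 + 2\<close>: twice the bound for the truncation plus twice
      the squared transfer error.\<close>
    then show ?case using A B by (simp add: algebra_simps)
  qed
qed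

end

section \<open>Slices of the essential range\<close>

text \<open>A mesh bound d is met by the constant gauge of balls of radius d/3. The result is wanted
  for the Lebesgue measurability of slices.\<close>

lemma riemann_integrable_imp_integrable:
  fixes f :: "real \<Rightarrow> 'b::euclidean_space"
  assumes "f riemann_integrable_on {0..1}"
  shows "f integrable_on {0..1}"
proof -
  obtain I where I: "\<And>e. e > 0 \<Longrightarrow> \<exists>d>0. \<forall>p. p tagged_division_of {0..1} \<and> (\<forall>(x, K)\<in>p. diameter K < d) \<longrightarrow>
        norm ((\<Sum>(x, K)\<in>p. measure lborel K *\<^sub>R f x) - I) < e"
    using assms unfolding riemann_integrable_on_def by metis
  have "(f has_integral I) (cbox 0 1)"
    unfolding has_integral
  proof (intro allI impI)
    fix e :: real assume "e > 0"
    then obtain d where d: "d > 0" "\<And>p. p tagged_division_of {0..1} \<Longrightarrow> (\<forall>(x, K)\<in>p. diameter K < d) \<Longrightarrow>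
        norm ((\<Sum>(x, K)\<in>p. measure lborel K *\<^sub>R f x) - I) < e"
      using I by metis
    have "norm ((\<Sum>(x, K)\<in>p. measure lborel K *\<^sub>R f x) - I) < e"
      if p: "p tagged_division_of cbox 0 1" "(\<lambda>x. ball x (d / 3)) fine p" for p
    proof (rule d(2))
      show "p tagged_division_of {0..1}" using p(1) by simp
      have "diameter K < d" if "(x, K) \<in> p" for x K
      proof -
        have "K \<subseteq> ball x (d / 3)" using p(2) that by (auto simp: fine_def)
        from diameter_subset[OF this bounded_ball] d(1) show ?thesis by simp
      qed
      then show "\<forall>(x, K)\<in>p. diameter K < d" by auto
    qed
    moreover have "gauge (\<lambda>x::real. ball x (d / 3))" using d(1) by (simp add: gauge_def)
    ultimately show "\<exists>\<gamma>. gauge \<gamma> \<and> (\<forall>p. p tagged_division_of cbox 0 1 \<and> \<gamma> fine p \<longrightarrow>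
        norm ((\<Sum>(x, K)\<in>p. measure lborel K *\<^sub>R f x) - I) < e)" by blast
  qed
  then show ?thesis unfolding integrable_on_def by auto
qed

text \<open>The product measure lives on Borel sets before completion, so the Borel part of
  \<open>A\<close> and its negligible part are multiplied by \<open>I\<close> separately.\<close>

lemma lebesgue_measurable_Times_borel:
  fixes A I :: "real set"
  assumes A: "A \<in> sets lebesgue" and I: "I \<in> sets borel"
  shows "A \<times> I \<in> sets lebesgue"
proof -
  obtain S N N' where SN: "A = S \<union> N" "N \<subseteq> N'" "N' \<in> null_sets lborel" "S \<in> sets lborel"
    using sets_completionE[OF A] by metis
  show ?thesis
  proof (rule sets_completionI)
    show "A \<times> I = (S \<times> I) \<union> (N \<times> I)" using SN(1) by blast
    show "N \<times> I \<subseteq> N' \<times> I" using SN(2) by blast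
    have "emeasure (lborel \<Otimes>\<^sub>M lborel) (N' \<times> I) = emeasure lborel N' * emeasure lborel I"
      using SN(3) I by (intro lborel.emeasure_pair_measure_Times) auto
    moreover have "N' \<times> I \<in> sets (lborel \<Otimes>\<^sub>M lborel)"
      using SN(3) I by (intro pair_measureI) auto
    ultimately show "N' \<times> I \<in> null_sets lborel"
      using SN(3) unfolding lborel_prod by (auto simp: null_sets_def)
    have "S \<times> I \<in> sets (lborel \<Otimes>\<^sub>M lborel)"
      using SN(4) I by (intro pair_measureI) auto
    then show "S \<times> I \<in> sets lborel" unfolding lborel_prod .
  qed
qed

text \<open>The measure of a rectangle is the product of those of its sides; this carries null sets
  of the plane down to slices.\<close>

lemma null_set_of_Times_subset_null_set:
  fixes A I :: "real set"
  assumes A: "A \<in> sets lebesgue" and I: "I \<in> sets borel" "emeasure lborel I \<noteq> 0"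
    and Z: "A \<times> I \<subseteq> Z" "Z \<in> null_sets lebesgue"
  shows "A \<in> null_sets lebesgue"
proof -
  obtain S N N' where SN: "A = S \<union> N" "N \<subseteq> N'" "N' \<in> null_sets lborel" "S \<in> sets lborel"
    using sets_completionE[OF A] by metis
  have S: "S \<times> I \<in> sets lborel"
    using SN(4) I by (subst lborel_prod[symmetric]) (intro pair_measureI; simp)
  have "emeasure lebesgue (S \<times> I) \<le> emeasure lebesgue Z"
    using Z SN(1) by (intro emeasure_mono) auto
  then have "emeasure lborel (S \<times> I) = 0"
    using S Z(2) by (simp add: null_sets_def)
  moreover have "emeasure lborel (S \<times> I) = emeasure lborel S * emeasure lborel I"
    using SN(4) I by (subst lborel_prod[symmetric]) (intro lborel.emeasure_pair_measure_Times; simp)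
  ultimately have "S \<in> null_sets lborel"
    using I(2) SN(4) by auto
  then have "S \<union> N' \<in> null_sets lebesgue"
    using SN(3) by (intro null_sets_completionI null_sets.Un)
  moreover have "A \<subseteq> S \<union> N'" using SN by blast
  ultimately show ?thesis
    using A by (metis null_sets_subset)
qed

lemma norm_cis_diff_le: "cmod (cis u - cis v) \<le> \<bar>u - v\<bar>"
proof -
  have "cis u - cis v = cis v * (cis (u - v) - 1)"
    by (simp add: right_diff_distrib cis_mult)
  then have "cmod (cis u - cis v) = cmod (cis (u - v) - 1)"
    by (simp add: norm_mult)
  also have "\<dots> = 2 * \<bar>sin ((u - v) / 2)\<bar>"
    using dist_exp_i_1[of "u - v"] by (simp add: cis_conv_exp)
  also have "\<dots> \<le> 2 * \<bar>(u - v) / 2\<bar>"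
    by (intro mult_left_mono abs_sin_x_le_abs_x) simp
  finally show ?thesis by simp
qed

section \<open>Equicontinuity in the frequency and slices at a fixed frequency\<close>

context fourier_family
begin

abbreviation "T \<equiv> {0..2 * pi}"

text \<open>The truncation is Lipschitz in t with a constant \<open>W\<close> independent of x, and
  the tail is uniformly small. Uniformity in x allows a whole slice to be moved to a nearby
  frequency at once.\<close>

lemma equicontinuous_a:
  assumes e: "e > 0"
  obtains h where "h > 0" "\<And>x s t. x \<in> {0..1} \<Longrightarrow> s \<in> T \<Longrightarrow> t \<in> T \<Longrightarrow> \<bar>s - t\<bar> < h \<Longrightarrow> cmod (a x s - a x t) \<le> e"
proof -
  obtain K where K: "\<And>S. finite S \<Longrightarrow> S \<inter> {- int K..int K} = {} \<Longrightarrow> sum M S \<le> e / 3"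
    using tail_bound[of "e / 3"] e by auto
  define W where "W = (\<Sum>k\<in>{- int K..int K}. M k * \<bar>real_of_int k\<bar>)"
  have W: "W \<ge> 0" unfolding W_def using M_nonneg by (intro sum_nonneg) auto
  have b: "cmod (band_symbol K c x s - band_symbol K c x t) \<le> W * \<bar>s - t\<bar>" if x: "x \<in> {0..1}" for x s t
  proof -
    have "band_symbol K c x s - band_symbol K c x t =
        (\<Sum>k\<in>{- int K..int K}. c k x * (cis (real_of_int k * s) - cis (real_of_int k * t)))"
      by (simp add: band_symbol_def sum_subtractf right_diff_distrib)
    also have "cmod \<dots> \<le> (\<Sum>k\<in>{- int K..int K}. M k * \<bar>real_of_int k\<bar> * \<bar>s - t\<bar>)"
    proof (intro sum_norm_le)
      fix k
      have "cmod (cis (real_of_int k * s) - cis (real_of_int k * t)) \<le> \<bar>real_of_int k\<bar> * \<bar>s - t\<bar>"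
        using norm_cis_diff_le[of "real_of_int k * s" "real_of_int k * t"]
        by (simp add: abs_mult flip: right_diff_distrib)
      then show "cmod (c k x * (cis (real_of_int k * s) - cis (real_of_int k * t))) \<le> M k * \<bar>real_of_int k\<bar> * \<bar>s - t\<bar>"
        unfolding norm_mult mult.assoc using norm_c_le[OF x] M_nonneg by (intro mult_mono) auto
    qed
    finally show ?thesis by (simp add: W_def sum_distrib_right)
  qed
  define h where "h = e / (3 * (W + 1))"
  show thesis
  proof (rule that)
    show "h > 0" using e W by (simp add: h_def)
    fix x s t :: real
    assume x: "x \<in> {0..1}" and st: "s \<in> T" "t \<in> T" and h: "\<bar>s - t\<bar> < h"
    have "W * \<bar>s - t\<bar> \<le> (W + 1) * h" using h W by (intro mult_mono) auto
    also have "\<dots> = e / 3" using W by (simp add: h_def field_simps)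
    finally have "cmod (band_symbol K c x s - band_symbol K c x t) \<le> e / 3"
      using b[OF x, of s t] by linarith
    moreover have "cmod (a x s - band_symbol K c x s) \<le> e / 3" "cmod (a x t - band_symbol K c x t) \<le> e / 3"
      by (rule norm_a_minus_band_symbol_le[OF _ x st(1)], rule K, assumption+,
          rule norm_a_minus_band_symbol_le[OF _ x st(2)], rule K)
    ultimately show "cmod (a x s - a x t) \<le> e" by norm
  qed
qed

lemma slice_measurable:
  assumes "t \<in> T" "open G"
  shows "{x \<in> {0..1}. a x t \<in> G} \<in> sets lebesgue"
proof -
  have "(\<lambda>x. a x t) integrable_on {0..1}"
    by (intro riemann_integrable_imp_integrable riemann_a assms)
  then obtain I where "((\<lambda>x. a x t) has_integral I) {0..1}"
    by (auto simp: integrable_on_def)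
  then have "(\<lambda>x. indicator {0..1} x *\<^sub>R a x t) \<in> borel_measurable lebesgue"
    by (rule has_integral_implies_lebesgue_measurable)
  then have "(\<lambda>x. a x t) \<in> borel_measurable (lebesgue_on {0..1})"
    by (subst borel_measurable_restrict_space_iff) simp_all
  then have "(\<lambda>x. a x t) -` G \<inter> space (lebesgue_on {0..1}) \<in> sets (lebesgue_on {0..1})"
    using assms(2) by (intro measurable_sets) auto
  then have "(\<lambda>x. a x t) -` G \<inter> {0..1} \<in> sets lebesgue"
    by (simp add: sets_restrict_space_iff space_restrict_space)
  moreover have "(\<lambda>x. a x t) -` G \<inter> {0..1} = {x \<in> {0..1}. a x t \<in> G}" by auto
  ultimately show ?thesis by simp
qed

text \<open>The interval is not centred at t, since at the ends of \<open>T\<close> only one side is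
  available.\<close>

lemma nearby_interval:
  assumes "t \<in> T" "h > 0"
  obtains p q where "p < q" "{p<..<q} \<subseteq> T \<inter> {s. \<bar>s - t\<bar> < h}"
proof -
  have "max 0 (t - h) < min (2 * pi) (t + h)" using assms pi_gt_zero by auto
  then show thesis by (rule that) auto
qed

definition preimage :: "complex set \<Rightarrow> (real \<times> real) set" where
  "preimage G = (\<lambda>(x, t). a x t) -` G \<inter> {0..1} \<times> T"

text \<open>Measurability in x and equicontinuity in t make the preimage a countable union of
  rectangles over rational frequencies q, with the ball shrunk by as much as \<open>a\<close> may
  change between q and t.\<close>

lemma preimage_ball_measurable: "preimage (ball z r) \<in> sets lebesgue"
proof -
  have "\<exists>h>0. \<forall>x\<in>{0..1}. \<forall>s\<in>T. \<forall>t\<in>T. \<bar>s - t\<bar> < h \<longrightarrow> cmod (a x s - a x t) \<le> 1 / real (Suc n)" for n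
  proof -
    obtain h where "h > 0" "\<And>x s t. x \<in> {0..1} \<Longrightarrow> s \<in> T \<Longrightarrow> t \<in> T \<Longrightarrow> \<bar>s - t\<bar> < h \<Longrightarrow> cmod (a x s - a x t) \<le> 1 / real (Suc n)"
      by (rule equicontinuous_a[of "1 / real (Suc n)"]) simp_all
    then show ?thesis by blast
  qed
  then obtain h where h: "\<And>n. h n > 0"
    "\<And>n x s t. x \<in> {0..1} \<Longrightarrow> s \<in> T \<Longrightarrow> t \<in> T \<Longrightarrow> \<bar>s - t\<bar> < h n \<Longrightarrow> cmod (a x s - a x t) \<le> 1 / real (Suc n)"
    by metis
  define P where "P n q = {x \<in> {0..1}. a x q \<in> ball z (r - 1 / real (Suc n))} \<times> (T \<inter> ball q (h n))" for n q
  have "preimage (ball z r) = (\<Union>n. \<Union>q\<in>\<rat> \<inter> T. P n q)"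
  proof (intro equalityI subsetI)
    fix v assume "v \<in> preimage (ball z r)"
    then obtain x t where v: "v = (x, t)" "x \<in> {0..1}" "t \<in> T" "dist z (a x t) < r"
      by (auto simp: preimage_def)
    \<comment> \<open>Half of the gap, as \<open>1 / Suc n\<close> is spent twice: in passing from t
      to q and in shrinking the ball.\<close>
    then obtain n where n: "1 / real (Suc n) < (r - dist z (a x t)) / 2"
      using nat_approx_posE[of "(r - dist z (a x t)) / 2"] by auto
    obtain p q' where pq: "p < q'" "{p<..<q'} \<subseteq> T \<inter> {s. \<bar>s - t\<bar> < h n}"
      by (rule nearby_interval[OF v(3) h(1)[of n]])
    obtain q where "q \<in> \<rat>" "p < q" "q < q'"
      using Rats_dense_in_real[OF pq(1)] by blast
    then have q: "q \<in> \<rat>" "q \<in> T" "\<bar>q - t\<bar> < h n"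
      using pq(2) by (auto dest!: subsetD[of _ _ q])
    have "dist (a x q) (a x t) \<le> 1 / real (Suc n)"
      using h(2)[OF v(2) q(2) v(3) q(3)] by (simp add: dist_norm)
    then have "dist z (a x q) < r - 1 / real (Suc n)"
      using dist_triangle[of z "a x q" "a x t"] n by (simp add: dist_commute)
    then have "v \<in> P n q"
      using v(1-3) q(3) unfolding P_def by (simp add: dist_real_def)
    then show "v \<in> (\<Union>n. \<Union>q\<in>\<rat> \<inter> T. P n q)"
      using q by blast
  next
    fix v assume "v \<in> (\<Union>n. \<Union>q\<in>\<rat> \<inter> T. P n q)"
    then obtain n q x t where *: "v = (x, t)" "x \<in> {0..1}" "t \<in> T" "q \<in> T" "\<bar>q - t\<bar> < h n"
      "dist z (a x q) < r - 1 / real (Suc n)"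
      unfolding P_def by (auto simp: dist_real_def)
    have "dist (a x q) (a x t) \<le> 1 / real (Suc n)"
      using h(2)[OF *(2,4,3,5)] by (simp add: dist_norm)
    then have "dist z (a x t) < r"
      using dist_triangle[of z "a x t" "a x q"] *(6) by linarith
    then show "v \<in> preimage (ball z r)"
      using * by (simp add: preimage_def)
  qed
  also have "\<dots> \<in> sets lebesgue"
  proof (intro sets.countable_UN'' countableI_type)
    show "countable (\<rat> \<inter> T)" using countable_rat by (rule countable_Int1)
    fix n q assume "q \<in> \<rat> \<inter> T"
    then show "P n q \<in> sets lebesgue"
      unfolding P_def by (intro lebesgue_measurable_Times_borel slice_measurable) auto
  qed
  finally show ?thesis .
qed

lemma essential_range_iff: "z \<in> essential_range a \<longleftrightarrow> (\<forall>r>0. emeasure lebesgue (preimage (ball z r)) > 0)"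
  by (simp add: essential_range_def preimage_def)

lemma not_essential_range_iff: "z \<notin> essential_range a \<longleftrightarrow> (\<exists>r>0. preimage (ball z r) \<in> null_sets lebesgue)"
  by (simp add: essential_range_iff null_sets_def preimage_ball_measurable zero_less_iff_neq_zero)

lemma compact_essential_range: "compact (essential_range a)"
proof -
  have "open (- essential_range a)"
    unfolding open_contains_ball
  proof safe
    fix z assume "z \<notin> essential_range a"
    then obtain r where r: "r > 0" "preimage (ball z r) \<in> null_sets lebesgue"
      unfolding not_essential_range_iff by blast
    have "w \<notin> essential_range a" if w: "w \<in> ball z r" for w
      unfolding not_essential_range_iff
    proof (intro exI conjI)
      show "r - dist z w > 0" using w by simp
      have "ball w (r - dist z w) \<subseteq> ball z r"
        by (intro ball_subset_ball_iff[THEN iffD2]) (simp add: dist_commute)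
      then have "preimage (ball w (r - dist z w)) \<subseteq> preimage (ball z r)"
        unfolding preimage_def by blast
      then show "preimage (ball w (r - dist z w)) \<in> null_sets lebesgue"
        using r(2) preimage_ball_measurable by (metis null_sets_subset)
    qed
    then show "\<exists>e>0. ball z e \<subseteq> - essential_range a" using r(1) by blast
  qed
  then have "closed (essential_range a)" by (simp add: closed_def)
  moreover have "essential_range a \<subseteq> cball 0 Mtot"
  proof
    fix z assume z: "z \<in> essential_range a"
    show "z \<in> cball 0 Mtot"
    proof (rule ccontr)
      assume "z \<notin> cball 0 Mtot"
      then have pos: "cmod z - Mtot > 0" by simp
      have "a x t \<notin> ball z (cmod z - Mtot)" if "x \<in> {0..1}" "t \<in> T" for x t
        using norm_a_le[OF that] norm_triangle_ineq2[of z "a x t"] by (auto simp: dist_norm)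
      then have "preimage (ball z (cmod z - Mtot)) = {}" by (auto simp: preimage_def)
      moreover have "emeasure lebesgue (preimage (ball z (cmod z - Mtot))) > 0"
        using z pos unfolding essential_range_iff by blast
      ultimately show False by simp
    qed
  qed
  ultimately show ?thesis
    unfolding compact_eq_bounded_closed by (blast intro: bounded_subset[OF bounded_cball])
qed

text \<open>By Lindelof, countably many balls of half radius cover the complement of the range. If
  the slice over such a ball had positive measure, equicontinuity would spread it to a rectangle of
  positive area in the preimage of the full ball, which is null. Fubini's theorem alone would give
  almost every t only.\<close>

lemma slice_null:
  assumes t: "t \<in> T"
  shows "{x \<in> {0..1}. a x t \<notin> essential_range a} \<in> null_sets lebesgue"
proof -
  define \<F> where "\<F> = {ball z (r / 2) | z r. r > 0 \<and> preimage (ball z r) \<in> null_sets lebesgue}"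
  have "\<And>S. S \<in> \<F> \<Longrightarrow> open S" by (auto simp: \<F>_def)
  then obtain \<G> where \<G>: "\<G> \<subseteq> \<F>" "countable \<G>" "\<Union>\<G> = \<Union>\<F>"
    using Lindelof by metis
  have cov: "- essential_range a \<subseteq> \<Union>\<F>"
  proof
    fix z assume "z \<in> - essential_range a"
    then obtain r where "r > 0" "preimage (ball z r) \<in> null_sets lebesgue"
      using not_essential_range_iff[of z] by blast
    then have "ball z (r / 2) \<in> \<F>" "z \<in> ball z (r / 2)" unfolding \<F>_def by auto
    then show "z \<in> \<Union>\<F>" by blast
  qed
  have null: "{x \<in> {0..1}. a x t \<in> B} \<in> null_sets lebesgue" if B_in: "B \<in> \<G>" for B
  proof -
    obtain z r where B: "B = ball z (r / 2)" and r: "r > 0" "preimage (ball z r) \<in> null_sets lebesgue"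
      using B_in \<G>(1) unfolding \<F>_def by blast
    \<comment> \<open>With r/4 the moved value stays within \<open>r/2 + r/4 < r\<close> of the
      centre.\<close>
    obtain h where h: "h > 0" "\<And>x s t. x \<in> {0..1} \<Longrightarrow> s \<in> T \<Longrightarrow> t \<in> T \<Longrightarrow> \<bar>s - t\<bar> < h \<Longrightarrow> cmod (a x s - a x t) \<le> r / 4"
      by (rule equicontinuous_a[of "r / 4"]) (use r(1) in simp_all)
    obtain p q where pq: "p < q" "{p<..<q} \<subseteq> T \<inter> {s. \<bar>s - t\<bar> < h}"
      by (rule nearby_interval[OF t h(1)])
    show ?thesis
    proof (rule null_set_of_Times_subset_null_set[where I = "{p<..<q}"])
      show "{x \<in> {0..1}. a x t \<in> B} \<in> sets lebesgue"
        using t by (intro slice_measurable) (auto simp: B)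
      show "emeasure lborel {p<..<q} \<noteq> 0" using pq(1) by simp
      show "{x \<in> {0..1}. a x t \<in> B} \<times> {p<..<q} \<subseteq> preimage (ball z r)"
      proof
        fix v assume "v \<in> {x \<in> {0..1}. a x t \<in> B} \<times> {p<..<q}"
        then obtain x s where v: "v = (x, s)" "x \<in> {0..1}" "dist z (a x t) < r / 2" "s \<in> {p<..<q}"
          by (auto simp: B)
        then have s: "s \<in> T" "\<bar>s - t\<bar> < h" using pq(2) by blast+
        have "dist (a x s) (a x t) \<le> r / 4"
          using h(2)[OF v(2) s(1) t s(2)] by (simp add: dist_norm)
        then have "dist z (a x s) < r"
          using dist_triangle[of z "a x s" "a x t"] v(3) r(1) by (simp add: dist_commute)
        then show "v \<in> preimage (ball z r)" using v s by (simp add: preimage_def)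
      qed
    qed (use r in auto)
  qed
  have "(\<Union>B\<in>\<G>. {x \<in> {0..1}. a x t \<in> B}) \<in> null_sets lebesgue"
    using \<G>(2) null by (rule null_sets_UN')
  moreover have "{x \<in> {0..1}. a x t \<notin> essential_range a} \<in> sets lebesgue"
    using slice_measurable[OF t, of "- essential_range a"] compact_essential_range
    by (simp add: compact_imp_closed open_Compl)
  moreover have "{x \<in> {0..1}. a x t \<notin> essential_range a} \<subseteq> (\<Union>B\<in>\<G>. {x \<in> {0..1}. a x t \<in> B})"
    using cov \<G>(3) by blast
  ultimately show ?thesis by (rule null_sets_subset)
qed

text \<open>A cell has positive length, so it cannot lie inside the null set of
  \<open>slice_null\<close>.\<close>

lemma tags_in_essential_range:
  assumes t: "t \<in> T"
  obtains \<xi> where "\<xi> \<in> cell_tags" "\<And>N i. i < N \<Longrightarrow> a (\<xi> N i) t \<in> essential_range a"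
proof -
  have "\<exists>x\<in>{real i / real N..real (i + 1) / real N}. a x t \<in> essential_range a" if i: "i < N" for N i
  proof (rule ccontr)
    let ?C = "{real i / real N..real (i + 1) / real N}"
    assume neg: "\<not> ?thesis"
    have "0 \<le> real i / real N" "real (i + 1) / real N \<le> 1" using i by (auto simp: divide_simps)
    then have "?C \<subseteq> {0..1}" by simp
    then have "?C \<subseteq> {x \<in> {0..1}. a x t \<notin> essential_range a}" using neg by blast
    moreover have "?C \<in> sets lebesgue" by simp
    ultimately have "?C \<in> null_sets lebesgue"
      using slice_null[OF t] by (metis null_sets_subset)
    moreover have "real i / real N < real (i + 1) / real N"
      using i by (intro divide_strict_right_mono) auto
    ultimately show False by (auto simp: null_sets_def)
  qed
  then have "\<forall>N i. \<exists>x. i < N \<longrightarrow> x \<in> {real i / real N..real (i + 1) / real N} \<and> a x t \<in> essential_range a"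
    by blast
  then obtain \<xi> where "\<forall>N i. i < N \<longrightarrow> \<xi> N i \<in> {real i / real N..real (i + 1) / real N} \<and> a (\<xi> N i) t \<in> essential_range a"
    by metis
  then show thesis by (intro that[of \<xi>]) (auto simp: cell_tags_def)
qed

end

section \<open>Counting eigenvalues\<close>

lemma order_prod_linear_factors:
  fixes z :: "'a::idom"
  shows "Polynomial.order z (\<Prod>e\<leftarrow>es. [:- e, 1:]) = count_list es z"
proof (induction es)
  case Nil
  show ?case by (simp add: order_0I)
next
  case (Cons e es)
  have "(\<Prod>e\<leftarrow>es. [:- e, 1:]) \<noteq> 0" by (auto simp: prod_list_zero_iff)
  then have "[:- e, 1:] * (\<Prod>e\<leftarrow>es. [:- e, 1:]) \<noteq> 0"
    by (simp only: mult_eq_0_iff pCons_eq_0_iff one_neq_zero simp_thms)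
  then have "Polynomial.order z (\<Prod>e\<leftarrow>e # es. [:- e, 1:]) =
      Polynomial.order z [:- e, 1:] + Polynomial.order z (\<Prod>e\<leftarrow>es. [:- e, 1:])"
    unfolding list.map prod_list.Cons by (rule Polynomial.order_mult)
  also have "Polynomial.order z [:- e, 1:] = (if e = z then 1 else 0)"
    using order_power_n_n[of z 1] by (auto intro: order_0I)
  finally show ?case using Cons.IH by simp
qed

lemma count_list_filter: "P z \<Longrightarrow> count_list (filter P xs) z = count_list xs z"
  by (induction xs) auto

lemma eigenvalue_count_eq_length_filter:
  assumes A: "A \<in> carrier_mat n n" and c: "char_poly A = (\<Prod>e\<leftarrow>es. [:- e, 1:])"
  shows "eigenvalue_count A V = length (filter (\<lambda>e. e \<in> V) es)"
proof -
  have nz: "(\<Prod>e\<leftarrow>es. [:- e, 1:]) \<noteq> 0" by (auto simp: prod_list_zero_iff)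
  have ev: "eigenvalue A z \<longleftrightarrow> z \<in> set es" for z
    unfolding eigenvalue_root_char_poly[OF A] c order_root order_prod_linear_factors
    using nz by (simp add: count_list_0_iff)
  have "eigenvalue_count A V = (\<Sum>z\<in>set (filter (\<lambda>e. e \<in> V) es). count_list (filter (\<lambda>e. e \<in> V) es) z)"
    unfolding eigenvalue_count_def c order_prod_linear_factors ev
    by (intro sum.cong) (auto simp: count_list_filter)
  also have "\<dots> = length (filter (\<lambda>e. e \<in> V) es)"
    by (rule sum_count_set) auto
  finally show ?thesis .
qed

lemma length_filter_le_sum_list:
  assumes "\<And>x. x \<in> set xs \<Longrightarrow> 0 \<le> f x" "\<And>x. x \<in> set xs \<Longrightarrow> P x \<Longrightarrow> 1 \<le> f x"
  shows "real (length (filter P xs)) \<le> (\<Sum>x\<leftarrow>xs. f x)"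
  using assms by (induction xs) (fastforce+)

lemma sum_list_sum_swap: "(\<Sum>x\<leftarrow>xs. \<Sum>q\<in>F. f q x) = (\<Sum>q\<in>F. \<Sum>x\<leftarrow>xs. f q x :: real)"
  by (induction xs) (simp_all add: sum.distrib)

text \<open>Chebyshev's inequality: each eigenvalue off \<open>V\<close> adds at least 1 to the sum
  of \<open>|q(e)|^2\<close> over \<open>F\<close>, and Schur's inequality bounds the total.\<close>

lemma eigenvalues_outside_le:
  assumes A: "A \<in> carrier_mat n n" and F: "finite F" "\<And>w. w \<notin> V \<Longrightarrow> \<exists>q\<in>F. 1 \<le> cmod (poly q w)"
  shows "real n - real (eigenvalue_count A V) \<le> (\<Sum>q\<in>F. frob (mat_poly A q))"
proof -
  obtain es where es: "char_poly A = (\<Prod>e\<leftarrow>es. [:- e, 1:])" "length es = n"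
    using char_poly_factorized[OF A] by blast
  have "real n - real (eigenvalue_count A V) = real (length (filter (\<lambda>e. e \<notin> V) es))"
    using sum_length_filter_compl[of "\<lambda>e. e \<in> V" es] es(2)
    unfolding eigenvalue_count_eq_length_filter[OF A es(1)] by simp
  also have "\<dots> \<le> (\<Sum>e\<leftarrow>es. \<Sum>q\<in>F. (cmod (poly q e))\<^sup>2)"
  proof (rule length_filter_le_sum_list)
    fix e assume "e \<notin> V"
    then obtain q where q: "q \<in> F" "1 \<le> cmod (poly q e)" using F(2) by blast
    have "1 \<le> (cmod (poly q e))\<^sup>2" using q(2) by (rule one_le_power)
    also have "\<dots> \<le> (\<Sum>q\<in>F. (cmod (poly q e))\<^sup>2)" using q(1) F(1) by (intro member_le_sum) auto
    finally show "1 \<le> (\<Sum>q\<in>F. (cmod (poly q e))\<^sup>2)" .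
  qed (simp add: sum_nonneg)
  also have "\<dots> = (\<Sum>q\<in>F. \<Sum>e\<leftarrow>es. (cmod (poly q e))\<^sup>2)"
    by (rule sum_list_sum_swap)
  also have "\<dots> \<le> (\<Sum>q\<in>F. frob (mat_poly A q))"
    by (intro sum_mono schur_inequality[OF A es(1)])
  finally show ?thesis .
qed

lemma eigenvalue_count_le:
  assumes A: "A \<in> carrier_mat n n"
  shows "eigenvalue_count A V \<le> n"
proof -
  obtain es where es: "char_poly A = (\<Prod>e\<leftarrow>es. [:- e, 1:])" "length es = n"
    using char_poly_factorized[OF A] by blast
  then show ?thesis
    unfolding eigenvalue_count_eq_length_filter[OF A es(1)] by (metis length_filter_le)
qed

context fourier_family
begin

lemma extended_range_cluster:
  assumes V: "open V" "extended_range a \<subseteq> V"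
  shows "(\<lambda>N. real (eigenvalue_count (symbol_matrix c N) V) / real N) \<longlonglongrightarrow> 1"
proof -
  obtain F where F: "finite F"
    "\<And>p z. p \<in> F \<Longrightarrow> z \<in> essential_range a \<Longrightarrow> cmod (poly p z) \<le> 1 / 2"
    "\<And>w. w \<notin> V \<Longrightarrow> \<exists>p\<in>F. 1 \<le> cmod (poly p w)"
    using finite_poly_separating_family[OF compact_essential_range V(1)] V(2)
    unfolding extended_range_def by metis
  let ?e = "\<lambda>N. real (eigenvalue_count (symbol_matrix c N) V)"
  show ?thesis
  proof (rule LIMSEQ_I)
    fix e :: real assume e: "e > 0"
    \<comment> \<open>The proportion off \<open>V\<close> will be at most
      \<open>12 * card F * (1/4)^m\<close>; the added 1 keeps the denominator positive even for
      empty \<open>F\<close>.\<close>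
    obtain m where m: "(1 / 4) ^ m < e / (12 * real (card F) + 1)"
      using real_arch_pow_inv[of "e / (12 * real (card F) + 1)" "1 / 4"] e by auto
    have "\<forall>\<^sub>F N in sequentially. frob (mat_poly (symbol_matrix c N) (p ^ m)) \<le> 12 * ((1 / 2) ^ m)\<^sup>2 * real N"
      if p: "p \<in> F" for p
    proof (rule frob_mat_poly_eventually_le)
      fix t assume t: "t \<in> {0..2 * pi}"
      obtain \<xi> where \<xi>: "\<xi> \<in> cell_tags" "\<And>N i. i < N \<Longrightarrow> a (\<xi> N i) t \<in> essential_range a"
        using tags_in_essential_range[OF t] by metis
      have "cmod (poly (p ^ m) (a (\<xi> N i) t)) \<le> (1 / 2) ^ m" if "i < N" for N i
        unfolding poly_power norm_power by (intro power_mono F(2)[OF p \<xi>(2)[OF that]]) simp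
      then show "\<exists>\<xi>\<in>cell_tags. \<forall>N. \<forall>i<N. cmod (poly (p ^ m) (a (\<xi> N i) t)) \<le> (1 / 2) ^ m"
        using \<xi>(1) by blast
    qed simp
    then have "\<forall>\<^sub>F N in sequentially. \<forall>p\<in>F. frob (mat_poly (symbol_matrix c N) (p ^ m)) \<le> 12 * ((1 / 2) ^ m)\<^sup>2 * real N"
      using F(1) by (simp add: eventually_ball_finite)
    then have "\<forall>\<^sub>F N in sequentially. norm (?e N / real N - 1) < e"
      using eventually_gt_at_top[of 0]
    proof eventually_elim
      case (elim N)
      have "\<exists>q\<in>(\<lambda>p. p ^ m) ` F. 1 \<le> cmod (poly q w)" if "w \<notin> V" for w
        using F(3)[OF that] by (auto simp: norm_power intro: one_le_power)
      then have "real N - ?e N \<le> (\<Sum>q\<in>(\<lambda>p. p ^ m) ` F. frob (mat_poly (symbol_matrix c N) q))"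
        using F(1) by (intro eigenvalues_outside_le) auto
      \<comment> \<open>Different members of \<open>F\<close> may have equal m-th powers, hence an
        inequality.\<close>
      also have "\<dots> \<le> (\<Sum>p\<in>F. frob (mat_poly (symbol_matrix c N) (p ^ m)))"
        using F(1) by (intro order_trans[OF sum_image_le]) (auto simp: frob_def sum_nonneg)
      also have "\<dots> \<le> (\<Sum>p\<in>F. 12 * ((1 / 2) ^ m)\<^sup>2 * real N)"
        using elim(1) by (intro sum_mono) auto
      also have "((1 / 2 :: real) ^ m)\<^sup>2 = (1 / 4) ^ m"
        by (simp add: power2_eq_square flip: power_mult_distrib)
      finally have "real N - ?e N \<le> (12 * real (card F) * (1 / 4) ^ m) * real N" by simp
      moreover have "12 * real (card F) * (1 / 4) ^ m < e"
      proof -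
        have "12 * real (card F) * (1 / 4) ^ m \<le> (12 * real (card F) + 1) * (1 / 4) ^ m"
          by (intro mult_right_mono) auto
        also have "\<dots> < e" using m by (simp add: field_simps)
        finally show ?thesis .
      qed
      ultimately have "real N - ?e N < e * real N"
        using elim(2) by (meson le_less_trans mult_strict_right_mono of_nat_0_less_iff)
      moreover have "?e N \<le> real N"
        using eigenvalue_count_le[OF symbol_matrix_carrier] by simp
      moreover have "norm (?e N / real N - 1) = \<bar>?e N - real N\<bar> / real N"
      proof -
        have "?e N / real N - 1 = (?e N - real N) / real N"
          using elim(2) by (simp add: diff_divide_distrib)
        then show ?thesis by (simp only: real_norm_def abs_divide abs_of_nat)
      qed
      ultimately show ?case using elim(2) by (simp add: pos_divide_less_eq)
    qed
    then show "\<exists>no. \<forall>N\<ge>no. norm (?e N / real N - 1) < e"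
      by (simp add: eventually_sequentially)
  qed
qed

end

section \<open>Passage to the Fourier coefficients of the symbol\<close>

lemma kms_matrix_eq_symbol_matrix: "kms_matrix a n = symbol_matrix (fourier_coeff a) (Suc n)"
  unfolding kms_matrix_def symbol_matrix_def by (intro eq_matI) (auto simp: algebra_simps)

text \<open>A finite total in the extended reals makes every sup norm finite, so
  \<open>enn2real\<close> loses nothing and the real partial sums are bounded.\<close>

lemma coeff_family_fourier_coeff:
  assumes "(\<Sum>\<^sub>\<infinity>k\<in>UNIV. fourier_coeff_sup_norm a k) < \<infinity>"
  shows "coeff_family (fourier_coeff a) (\<lambda>k. enn2real (fourier_coeff_sup_norm a k))"
proof
  let ?S = "\<Sum>\<^sub>\<infinity>k\<in>UNIV. fourier_coeff_sup_norm a k"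
  have le: "sum (fourier_coeff_sup_norm a) X \<le> ?S" if "finite X" for X
    using that by (subst nonneg_infsum_complete) (auto intro: SUP_upper)
  have fin: "fourier_coeff_sup_norm a k < \<infinity>" for k
    using le[of "{k}"] assms by (auto intro: le_less_trans)
  then have en: "ennreal (enn2real (fourier_coeff_sup_norm a k)) = fourier_coeff_sup_norm a k" for k
    by (intro ennreal_enn2real) simp
  show "(\<lambda>k. enn2real (fourier_coeff_sup_norm a k)) summable_on UNIV"
  proof (rule nonneg_bounded_partial_sums_imp_summable_on[where C = "enn2real ?S"])
    show "\<forall>\<^sub>F X in finite_subsets_at_top UNIV. (\<Sum>k\<in>X. enn2real (fourier_coeff_sup_norm a k)) \<le> enn2real ?S"
    proof (rule eventually_finite_subsets_at_top_weakI)
      fix X :: "int set" assume X: "finite X"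
      have "ennreal (\<Sum>k\<in>X. enn2real (fourier_coeff_sup_norm a k)) = sum (fourier_coeff_sup_norm a) X"
        by (subst sum_ennreal[symmetric]) (simp_all add: en)
      also have "\<dots> \<le> ?S" by (rule le[OF X])
      also have "\<dots> = ennreal (enn2real ?S)"
        using assms by (intro ennreal_enn2real[symmetric]) simp
      finally show "(\<Sum>k\<in>X. enn2real (fourier_coeff_sup_norm a k)) \<le> enn2real ?S"
        by (simp add: ennreal_le_iff)
    qed
  qed simp
  show "cmod (fourier_coeff a k x) \<le> enn2real (fourier_coeff_sup_norm a k)" if "x \<in> {0..1}" for x k
  proof -
    have "ennreal (cmod (fourier_coeff a k x)) \<le> fourier_coeff_sup_norm a k"
      unfolding fourier_coeff_sup_norm_def using that by (rule SUP_upper)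
    then have "ennreal (cmod (fourier_coeff a k x)) \<le> ennreal (enn2real (fourier_coeff_sup_norm a k))"
      by (simp only: en)
    then show ?thesis by (simp add: ennreal_le_iff)
  qed
qed

theorem theorem2p11:
  fixes a :: "real \<Rightarrow> real \<Rightarrow> complex" and V :: "complex set"
  assumes fourier_series: "\<And>x t. x \<in> {0..1} \<Longrightarrow> t \<in> {0..2*pi} \<Longrightarrow>
        ((\<lambda>k::int. fourier_coeff a k x * exp (\<i> * of_int k * of_real t)) has_sum a x t) UNIV"
    and riemann: "\<And>t. t \<in> {0..2*pi} \<Longrightarrow> (\<lambda>x. a x t) riemann_integrable_on {0..1}"
    and L_infinity: "\<And>x. x \<in> {0..1} \<Longrightarrow> in_L_infinity {0..2*pi} (a x)"
    and summable: "(\<Sum>\<^sub>\<infinity>k\<in>UNIV. fourier_coeff_sup_norm a k) < \<infinity>"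
    and V: "open V" "extended_range a \<subseteq> V"
  shows "(\<lambda>n. real (eigenvalue_count (kms_matrix a n) V) / real (n + 1)) \<longlonglongrightarrow> 1"
proof -
  interpret coeff_family "fourier_coeff a" "\<lambda>k. enn2real (fourier_coeff_sup_norm a k)"
    by (rule coeff_family_fourier_coeff[OF summable])
  interpret fourier_family "fourier_coeff a" "\<lambda>k. enn2real (fourier_coeff_sup_norm a k)" a
  proof
    fix x t :: real assume xt: "x \<in> {0..1}" "t \<in> {0..2 * pi}"
    have "exp (\<i> * of_int k * of_real t) = cis (real_of_int k * t)" for k
      by (simp add: cis_conv_exp mult_ac)
    then show "((\<lambda>k. fourier_coeff a k x * cis (real_of_int k * t)) has_sum a x t) UNIV"
      using fourier_series[OF xt] by simp
  qed (rule riemann)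
  \<comment> \<open>The order is \<open>n + 1\<close>, so the limit along the orders is shifted by
    one.\<close>
  have "(\<lambda>n. real (eigenvalue_count (symbol_matrix (fourier_coeff a) (Suc n)) V) / real (Suc n)) \<longlonglongrightarrow> 1"
    by (rule LIMSEQ_Suc[OF extended_range_cluster[OF V]])
  then show ?thesis
    by (simp only: kms_matrix_eq_symbol_matrix Suc_eq_plus1)
qed

end
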